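(* Let $G=\widetilde{Diff(S^1)}=Diff_{\mathbb Z}(\mathbb R)$ be the group of orientation preserving $\mathbb Z$-equivariant diffeomorphisms of $\mathbb R$, let $\pi:G\to Diff(S^1)$ be the universal covering, let $\underline{F_0}$, $\underline{F_1}$ be the $G$-modules of smooth functions and smooth $1$-forms on $\mathbb R$, and let $\pi^*B_1$ be the $2$-cocycle of $G$ with values in $\underline{F_1}$ given by $\pi^*B_1(\Phi,\Psi)=\Psi^*(\log\Phi')\cdot d\log(\Psi')$. Then the crossed module of groups $$0\to\mathbb R\to\underline{F_0}\to\underline{F_1}\times_{\pi^*B_1}\widetilde{Diff(S^1)}\to\widetilde{Diff(S^1)}\to1$$ represents the Godbillon–Vey cocycle in $H^3(\widetilde{Diff(S^1)},\mathbb R)$.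
   Context: $Diff(S^1)$ is the Fréchet Lie group of orientation preserving diffeomorphisms of the circle; $G$ is its (contractible) universal covering group. Group cohomology is with continuous cochains. Modules: $G$ acts on $\underline{F_\lambda}$ ($\lambda=0,1$) on the right by pull-back $a\mapsto\Psi^*a$. $B_1$ is the $2$-cocycle on $Diff(S^1)$ given by the formula $B_1(\Phi,\Psi)=\Psi^*(l\Phi)\,dl\Psi$ with $l\Phi=\log\Phi'$, $dl\Phi=\frac{\Phi''}{\Phi'}dx$; its pull-back to $G$ is taken with values in the $1$-densities on $\mathbb R$. Crossed module: $\underline{F_1}\times_{\pi^*B_1}G$ is the set $\underline{F_1}\times G$ with product $(a,\Phi)(b,\Psi)=(\Psi^*a+b+\pi^*B_1(\Phi,\Psi),\Phi\circ\Psi)$; the map $\mu:\underline{F_0}\to\underline{F_1}\times_{\pi^*B_1}G$ is $a\mapsto(da,\mathrm{id})$ ($d$ the de Rham differential), with $\underline{F_1}\times_{\pi^*B_1}G$ acting on $\underline{F_0}$ by $(b,\Phi)\cdot a=(\Phi^{-1})^*a$; $\mathbb R\to\underline{F_0}$ is the inclusion of constants. A crossed module of groups is a homomorphism $\mu:M\to N$ with an action of $N$ on $M$ by automorphisms such that $\mu(n\cdot m)=n\mu(m)n^{-1}$ and $\mu(m)\cdot m'=mm'm^{-1}$. Class represented: for a crossed module with kernel $V$ and cokernel $G$, choose a section $\rho$ of $N\to G$ and $\beta:G\times G\to M$ with $\rho(x)\rho(y)=\mu(\beta(x,y))\rho(xy)$; then $\gamma(x,y,z)=(\rho(x)\cdot\beta(y,z))\,\beta(x,yz)\,\beta(xy,z)^{-1}\beta(x,y)^{-1}\in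 V$ is a $3$-cocycle and the crossed module represents its class in $H^3(G,V)$ (here all choices are continuous). Godbillon–Vey class: on the Lie algebra $Vect(S^1)$ of smooth vector fields, lifted to periodic vector fields $f\frac{d}{dx}$ on $\mathbb R$, the Godbillon–Vey $3$-cocycle is $$\theta(0)(f,g,h)=\begin{vmatrix} f&g&h\\ f'&g'&h'\\ f''&g''&h''\end{vmatrix}(0).$$ Since $G$ is contractible, the van Est (Hochschild–Mostow) theorem gives an isomorphism $H^*(G,\mathbb R)\cong H^*(Vect(S^1);\mathbb R)$ between continuous group cohomology and continuous Lie algebra cohomology; the Godbillon–Vey class in $H^3(G,\mathbb R)$ is the one corresponding to $[\theta(0)]$. *)

theory Defs
  imports "HOL-Analysis.Analysis" "HOL-Algebra.Algebra"
begin

section \<open>Smooth functions on the line and the group of equivariant diffeomorphisms\<close>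

type_synonym fn = "real \<Rightarrow> real"

definition smooth_fns :: "fn set" where
  "smooth_fns = {a. \<forall>n. (deriv ^^ n) a differentiable_on UNIV}"

text \<open>The Frechet topology: uniform convergence of all derivatives on compact sets.\<close>

definition smooth_ball :: "nat \<Rightarrow> real \<Rightarrow> real \<Rightarrow> fn \<Rightarrow> fn set" where
  "smooth_ball n r e a =
     {b \<in> smooth_fns. \<forall>k\<le>n. \<forall>x\<in>{-r..r}. \<bar>(deriv ^^ k) b x - (deriv ^^ k) a x\<bar> < e}"

definition smooth_top :: "fn topology" where
  "smooth_top = topology_generated_by {smooth_ball n r e a | n r e a. a \<in> smooth_fns \<and> e > 0}"

definition diffZ :: "fn monoid" where
  "diffZ = \<lparr>carrier = {\<Phi>. bij \<Phi> \<and> \<Phi> \<in> smooth_fns \<and> inv_into UNIV \<Phi> \<in> smooth_fns \<and>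
                           (\<forall>x. deriv \<Phi> x > 0) \<and> (\<forall>x (n::int). \<Phi> (x + of_int n) = \<Phi> x + of_int n)},
            mult = (\<lambda>\<Phi> \<Psi>. \<Phi> \<circ> \<Psi>), one = id\<rparr>"

definition diffZ_top :: "fn topology" where
  "diffZ_top = subtopology smooth_top (carrier diffZ)"

text \<open>Vector fields on the circle, lifted to the line: \<open>f\<close> stands for \<open>f d/dx\<close>.\<close>

definition vect :: "fn set" where
  "vect = {f \<in> smooth_fns. \<forall>x. f (x + 1) = f x}"

definition vect_top :: "fn topology" where
  "vect_top = subtopology smooth_top vect"

definition vbracket :: "fn \<Rightarrow> fn \<Rightarrow> fn" where
  "vbracket f g = (\<lambda>x. f x * deriv g x - deriv f x * g x)"


section \<open>The modules of functions and 1-forms, and the crossed module\<close>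

text \<open>The 1-form \<open>a dx\<close> is represented by its coefficient function \<open>a\<close>; thus the modules of
  functions and of 1-forms have the same underlying topological group, they differ in the pull-back,
  and the de Rham differential of a function is \<^const>\<open>deriv\<close>.\<close>

definition pullback0 :: "fn \<Rightarrow> fn \<Rightarrow> fn" where
  "pullback0 \<Psi> a = (\<lambda>x. a (\<Psi> x))"

definition pullback1 :: "fn \<Rightarrow> fn \<Rightarrow> fn" where
  "pullback1 \<Psi> a = (\<lambda>x. a (\<Psi> x) * deriv \<Psi> x)"

definition log_deriv :: "fn \<Rightarrow> fn" where
  "log_deriv \<Phi> = (\<lambda>x. ln (deriv \<Phi> x))"

definition B1 :: "fn \<Rightarrow> fn \<Rightarrow> fn" where
  "B1 \<Phi> \<Psi> = (\<lambda>x. pullback0 \<Psi> (log_deriv \<Phi>) x * deriv (log_deriv \<Psi>) x)"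

definition F0 :: "fn monoid" where
  "F0 = \<lparr>carrier = smooth_fns, mult = (\<lambda>a b x. a x + b x), one = (\<lambda>x. 0)\<rparr>"

definition F1_ext :: "(fn \<times> fn) monoid" where
  "F1_ext = \<lparr>carrier = smooth_fns \<times> carrier diffZ,
     mult = (\<lambda>(a, \<Phi>) (b, \<Psi>). (\<lambda>x. pullback1 \<Psi> a x + b x + B1 \<Phi> \<Psi> x, \<Phi> \<circ> \<Psi>)),
     one = (\<lambda>x. 0, id)\<rparr>"

definition F1_ext_top :: "(fn \<times> fn) topology" where
  "F1_ext_top = prod_topology smooth_top diffZ_top"

definition mu :: "fn \<Rightarrow> fn \<times> fn" where
  "mu a = (deriv a, id)"

definition F1_ext_act :: "fn \<times> fn \<Rightarrow> fn \<Rightarrow> fn" where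
  "F1_ext_act = (\<lambda>(b, \<Phi>) a. pullback0 (inv_into UNIV \<Phi>) a)"

definition real_grp :: "real monoid" where
  "real_grp = \<lparr>carrier = UNIV, mult = (+), one = 0\<rparr>"

definition const_fn :: "real \<Rightarrow> fn" where
  "const_fn r = (\<lambda>x. r)"


section \<open>Crossed modules of groups\<close>

text \<open>\<^const>\<open>AutoGroup\<close> consists of extensional functions, hence the restriction of the action.\<close>

definition crossed_module ::
  "'m monoid \<Rightarrow> 'n monoid \<Rightarrow> ('m \<Rightarrow> 'n) \<Rightarrow> ('n \<Rightarrow> 'm \<Rightarrow> 'm) \<Rightarrow> bool" where
  "crossed_module M N \<mu> act \<longleftrightarrow>
     group M \<and> group N \<and> \<mu> \<in> hom M N \<and>
     (\<lambda>n. \<lambda>m\<in>carrier M. act n m) \<in> hom N (AutoGroup M) \<and>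
     (\<forall>n\<in>carrier N. \<forall>m\<in>carrier M. \<mu> (act n m) = n \<otimes>\<^bsub>N\<^esub> \<mu> m \<otimes>\<^bsub>N\<^esub> m_inv N n) \<and>
     (\<forall>m\<in>carrier M. \<forall>m'\<in>carrier M. act (\<mu> m) m' = m \<otimes>\<^bsub>M\<^esub> m' \<otimes>\<^bsub>M\<^esub> m_inv M m)"

text \<open>A crossed module sitting in an exact sequence \<open>1 \<rightarrow> V \<rightarrow> M \<rightarrow> N \<rightarrow> G \<rightarrow> 1\<close>, where the
  \<open>G\<close>-module structure that the kernel \<open>V\<close> inherits from the action of \<open>N\<close> is the trivial one.\<close>

definition crossed_module_seq ::
  "'v monoid \<Rightarrow> ('v \<Rightarrow> 'm) \<Rightarrow> 'm monoid \<Rightarrow> ('m \<Rightarrow> 'n) \<Rightarrow> 'n monoid \<Rightarrow> ('n \<Rightarrow> 'g) \<Rightarrow> 'g monoid \<Rightarrow>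
   ('n \<Rightarrow> 'm \<Rightarrow> 'm) \<Rightarrow> bool" where
  "crossed_module_seq V \<iota> M \<mu> N p G act \<longleftrightarrow>
     crossed_module M N \<mu> act \<and>
     group V \<and> \<iota> \<in> hom V M \<and> inj_on \<iota> (carrier V) \<and> \<iota> ` carrier V = kernel M N \<mu> \<and>
     group G \<and> p \<in> hom N G \<and> \<mu> ` carrier M = kernel N G p \<and> p ` carrier N = carrier G \<and>
     (\<forall>n\<in>carrier N. \<forall>v\<in>carrier V. act n (\<iota> v) = \<iota> v)"


section \<open>Continuous group cohomology in degree 3 with trivial real coefficients\<close>

definition cont_cochain2 :: "'g topology \<Rightarrow> ('g \<Rightarrow> 'g \<Rightarrow> real) \<Rightarrow> bool" where
  "cont_cochain2 T b \<longleftrightarrow> continuous_map (prod_topology T T) euclideanreal (\<lambda>(x, y). b x y)"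

definition cont_cochain3 :: "'g topology \<Rightarrow> ('g \<Rightarrow> 'g \<Rightarrow> 'g \<Rightarrow> real) \<Rightarrow> bool" where
  "cont_cochain3 T c \<longleftrightarrow>
     continuous_map (prod_topology T (prod_topology T T)) euclideanreal (\<lambda>(x, y, z). c x y z)"

definition cobd2 :: "'g monoid \<Rightarrow> ('g \<Rightarrow> 'g \<Rightarrow> real) \<Rightarrow> 'g \<Rightarrow> 'g \<Rightarrow> 'g \<Rightarrow> real" where
  "cobd2 G b x y z = b y z - b (x \<otimes>\<^bsub>G\<^esub> y) z + b x (y \<otimes>\<^bsub>G\<^esub> z) - b x y"

definition cobd3 :: "'g monoid \<Rightarrow> ('g \<Rightarrow> 'g \<Rightarrow> 'g \<Rightarrow> real) \<Rightarrow> 'g \<Rightarrow> 'g \<Rightarrow> 'g \<Rightarrow> 'g \<Rightarrow> real" where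
  "cobd3 G c x y z w =
     c y z w - c (x \<otimes>\<^bsub>G\<^esub> y) z w + c x (y \<otimes>\<^bsub>G\<^esub> z) w - c x y (z \<otimes>\<^bsub>G\<^esub> w) + c x y z"

definition grp_Z3 :: "'g monoid \<Rightarrow> 'g topology \<Rightarrow> ('g \<Rightarrow> 'g \<Rightarrow> 'g \<Rightarrow> real) set" where
  "grp_Z3 G T = {c. cont_cochain3 T c \<and>
     (\<forall>x\<in>carrier G. \<forall>y\<in>carrier G. \<forall>z\<in>carrier G. \<forall>w\<in>carrier G. cobd3 G c x y z w = 0)}"

text \<open>Cochains are compared on the carrier only.\<close>

definition grp_coh3 ::
  "'g monoid \<Rightarrow> 'g topology \<Rightarrow> (('g \<Rightarrow> 'g \<Rightarrow> 'g \<Rightarrow> real) \<times> ('g \<Rightarrow> 'g \<Rightarrow> 'g \<Rightarrow> real)) set" where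
  "grp_coh3 G T = {(c, c'). c \<in> grp_Z3 G T \<and> c' \<in> grp_Z3 G T \<and>
     (\<exists>b. cont_cochain2 T b \<and>
        (\<forall>x\<in>carrier G. \<forall>y\<in>carrier G. \<forall>z\<in>carrier G. c' x y z - c x y z = cobd2 G b x y z))}"

definition grp_H3 :: "'g monoid \<Rightarrow> 'g topology \<Rightarrow> ('g \<Rightarrow> 'g \<Rightarrow> 'g \<Rightarrow> real) set set" where
  "grp_H3 G T = grp_Z3 G T // grp_coh3 G T"


section \<open>The cohomology class represented by a crossed module\<close>

definition cm_choice ::
  "'m monoid \<Rightarrow> 'm topology \<Rightarrow> ('m \<Rightarrow> 'n) \<Rightarrow> 'n monoid \<Rightarrow> 'n topology \<Rightarrow> ('n \<Rightarrow> 'g) \<Rightarrow>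
   'g monoid \<Rightarrow> 'g topology \<Rightarrow> ('g \<Rightarrow> 'n) \<Rightarrow> ('g \<Rightarrow> 'g \<Rightarrow> 'm) \<Rightarrow> bool" where
  "cm_choice M TM \<mu> N TN p G TG \<rho> \<beta> \<longleftrightarrow>
     continuous_map TG TN \<rho> \<and> (\<forall>x\<in>carrier G. p (\<rho> x) = x) \<and>
     continuous_map (prod_topology TG TG) TM (\<lambda>(x, y). \<beta> x y) \<and>
     (\<forall>x\<in>carrier G. \<forall>y\<in>carrier G. \<rho> x \<otimes>\<^bsub>N\<^esub> \<rho> y = \<mu> (\<beta> x y) \<otimes>\<^bsub>N\<^esub> \<rho> (x \<otimes>\<^bsub>G\<^esub> y))"

definition cm_gamma ::
  "'m monoid \<Rightarrow> 'g monoid \<Rightarrow> ('n \<Rightarrow> 'm \<Rightarrow> 'm) \<Rightarrow> ('g \<Rightarrow> 'n) \<Rightarrow> ('g \<Rightarrow> 'g \<Rightarrow> 'm) \<Rightarrow>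
   'g \<Rightarrow> 'g \<Rightarrow> 'g \<Rightarrow> 'm" where
  "cm_gamma M G act \<rho> \<beta> x y z =
     act (\<rho> x) (\<beta> y z) \<otimes>\<^bsub>M\<^esub> \<beta> x (y \<otimes>\<^bsub>G\<^esub> z) \<otimes>\<^bsub>M\<^esub> m_inv M (\<beta> (x \<otimes>\<^bsub>G\<^esub> y) z) \<otimes>\<^bsub>M\<^esub> m_inv M (\<beta> x y)"

text \<open>The class \<open>K\<close> is represented if continuous choices exist and every continuous choice
  leads to a cocycle in \<open>K\<close> (the values of that cocycle are read in \<open>\<real>\<close> through \<open>\<iota>\<close>).\<close>

definition cm_represents ::
  "(real \<Rightarrow> 'm) \<Rightarrow> 'm monoid \<Rightarrow> 'm topology \<Rightarrow> ('m \<Rightarrow> 'n) \<Rightarrow> 'n monoid \<Rightarrow> 'n topology \<Rightarrow>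
   ('n \<Rightarrow> 'g) \<Rightarrow> 'g monoid \<Rightarrow> 'g topology \<Rightarrow> ('n \<Rightarrow> 'm \<Rightarrow> 'm) \<Rightarrow>
   ('g \<Rightarrow> 'g \<Rightarrow> 'g \<Rightarrow> real) set \<Rightarrow> bool" where
  "cm_represents \<iota> M TM \<mu> N TN p G TG act K \<longleftrightarrow>
     K \<in> grp_H3 G TG \<and>
     (\<exists>\<rho> \<beta>. cm_choice M TM \<mu> N TN p G TG \<rho> \<beta>) \<and>
     (\<forall>\<rho> \<beta>. cm_choice M TM \<mu> N TN p G TG \<rho> \<beta> \<longrightarrow>
        (\<exists>c\<in>K. \<forall>x\<in>carrier G. \<forall>y\<in>carrier G. \<forall>z\<in>carrier G.
           \<iota> (c x y z) = cm_gamma M G act \<rho> \<beta> x y z))"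


section \<open>Continuous cohomology of the Lie algebra of vector fields in degree 3\<close>

definition alt2 :: "(fn \<Rightarrow> fn \<Rightarrow> real) \<Rightarrow> bool" where
  "alt2 \<eta> \<longleftrightarrow>
     continuous_map (prod_topology vect_top vect_top) euclideanreal (\<lambda>(f, g). \<eta> f g) \<and>
     (\<forall>f\<in>vect. \<forall>g\<in>vect. \<forall>h\<in>vect. \<forall>r s.
        \<eta> (\<lambda>x. r * f x + s * g x) h = r * \<eta> f h + s * \<eta> g h) \<and>
     (\<forall>f\<in>vect. \<forall>g\<in>vect. \<eta> g f = - \<eta> f g)"

definition alt3 :: "(fn \<Rightarrow> fn \<Rightarrow> fn \<Rightarrow> real) \<Rightarrow> bool" where
  "alt3 \<omega> \<longleftrightarrow>
     continuous_map (prod_topology vect_top (prod_topology vect_top vect_top)) euclideanreal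
       (\<lambda>(f, g, h). \<omega> f g h) \<and>
     (\<forall>f\<in>vect. \<forall>g\<in>vect. \<forall>h\<in>vect. \<forall>k\<in>vect. \<forall>r s.
        \<omega> (\<lambda>x. r * f x + s * g x) h k = r * \<omega> f h k + s * \<omega> g h k) \<and>
     (\<forall>f\<in>vect. \<forall>g\<in>vect. \<forall>h\<in>vect. \<omega> g f h = - \<omega> f g h \<and> \<omega> f h g = - \<omega> f g h)"

definition lie_d2 :: "(fn \<Rightarrow> fn \<Rightarrow> real) \<Rightarrow> fn \<Rightarrow> fn \<Rightarrow> fn \<Rightarrow> real" where
  "lie_d2 \<eta> f g h = - \<eta> (vbracket f g) h + \<eta> (vbracket f h) g - \<eta> (vbracket g h) f"

definition lie_d3 :: "(fn \<Rightarrow> fn \<Rightarrow> fn \<Rightarrow> real) \<Rightarrow> fn \<Rightarrow> fn \<Rightarrow> fn \<Rightarrow> fn \<Rightarrow> real" where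
  "lie_d3 \<omega> f g h k =
     - \<omega> (vbracket f g) h k + \<omega> (vbracket f h) g k - \<omega> (vbracket f k) g h
     - \<omega> (vbracket g h) f k + \<omega> (vbracket g k) f h - \<omega> (vbracket h k) f g"

definition lie_Z3 :: "(fn \<Rightarrow> fn \<Rightarrow> fn \<Rightarrow> real) set" where
  "lie_Z3 = {\<omega>. alt3 \<omega> \<and> (\<forall>f\<in>vect. \<forall>g\<in>vect. \<forall>h\<in>vect. \<forall>k\<in>vect. lie_d3 \<omega> f g h k = 0)}"

definition lie_coh3 :: "((fn \<Rightarrow> fn \<Rightarrow> fn \<Rightarrow> real) \<times> (fn \<Rightarrow> fn \<Rightarrow> fn \<Rightarrow> real)) set" where
  "lie_coh3 = {(\<omega>, \<omega>'). \<omega> \<in> lie_Z3 \<and> \<omega>' \<in> lie_Z3 \<and>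
     (\<exists>\<eta>. alt2 \<eta> \<and> (\<forall>f\<in>vect. \<forall>g\<in>vect. \<forall>h\<in>vect. \<omega>' f g h - \<omega> f g h = lie_d2 \<eta> f g h))}"

definition lie_H3 :: "(fn \<Rightarrow> fn \<Rightarrow> fn \<Rightarrow> real) set set" where
  "lie_H3 = lie_Z3 // lie_coh3"

definition lie_class :: "(fn \<Rightarrow> fn \<Rightarrow> fn \<Rightarrow> real) \<Rightarrow> (fn \<Rightarrow> fn \<Rightarrow> fn \<Rightarrow> real) set" where
  "lie_class \<omega> = lie_coh3 `` {\<omega>}"

definition theta0 :: "fn \<Rightarrow> fn \<Rightarrow> fn \<Rightarrow> real" where
  "theta0 f g h = det (vector
     [vector [f 0, g 0, h 0],
      vector [deriv f 0, deriv g 0, deriv h 0],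
      vector [deriv (deriv f) 0, deriv (deriv g) 0, deriv (deriv h) 0]] :: real^3^3)"


section \<open>The van Est isomorphism and the Godbillon--Vey class\<close>

text \<open>The group \<^const>\<open>diffZ\<close> is open in the affine space of the functions \<open>id + f\<close> with \<open>f\<close> in
  \<^const>\<open>vect\<close>; this is a global chart of the Frechet Lie group.  A function of three group elements
  is smooth if its iterated directional derivatives of all orders exist and are jointly continuous
  in the base point and the directions.\<close>

definition line3 :: "fn \<times> fn \<times> fn \<Rightarrow> fn \<times> fn \<times> fn \<Rightarrow> real \<Rightarrow> fn \<times> fn \<times> fn" where
  "line3 = (\<lambda>(\<Phi>, \<Psi>, \<Xi>) (f, g, h) t. (\<lambda>x. \<Phi> x + t * f x, \<lambda>x. \<Psi> x + t * g x, \<lambda>x. \<Xi> x + t * h x))"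

primrec dir_deriv3 ::
  "(fn \<Rightarrow> fn \<Rightarrow> fn \<Rightarrow> real) \<Rightarrow> nat \<Rightarrow> fn \<times> fn \<times> fn \<Rightarrow> (nat \<Rightarrow> fn \<times> fn \<times> fn) \<Rightarrow> real" where
  "dir_deriv3 c 0 P v = (case P of (\<Phi>, \<Psi>, \<Xi>) \<Rightarrow> c \<Phi> \<Psi> \<Xi>)"
| "dir_deriv3 c (Suc k) P v = deriv (\<lambda>t. dir_deriv3 c k (line3 P (v k) t) v) 0"

definition smooth_cochain3 :: "(fn \<Rightarrow> fn \<Rightarrow> fn \<Rightarrow> real) \<Rightarrow> bool" where
  "smooth_cochain3 c \<longleftrightarrow>
     (\<forall>k. (\<forall>P \<in> carrier diffZ \<times> carrier diffZ \<times> carrier diffZ.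
             \<forall>v \<in> {..k} \<rightarrow>\<^sub>E vect \<times> vect \<times> vect.
               (\<lambda>t. dir_deriv3 c k (line3 P (v k) t) v) differentiable (at 0)) \<and>
          continuous_map
            (prod_topology
               (prod_topology diffZ_top (prod_topology diffZ_top diffZ_top))
               (product_topology (\<lambda>_. prod_topology vect_top (prod_topology vect_top vect_top)) {..<k}))
            euclideanreal (\<lambda>(P, v). dir_deriv3 c k P v))"

text \<open>Differentiation of group cochains at the identity.  The bracket that left invariant vector
  fields induce on the tangent space of the diffeomorphism group at the identity is the negative of
  \<^const>\<open>vbracket\<close>; so the isomorphism from \<^const>\<open>vect\<close> to the Lie algebra of the group sends \<open>f\<close> to
  the tangent vector \<open>- f\<close>, here that of the curve \<open>id - s f\<close>.  This is also the identification for
  which the action of \<open>\<Phi>\<close> on functions by pull-back along its inverse differentiates to the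
  Lie derivative.  The mixed derivative only depends on the tangent vectors of the three curves.\<close>

definition mixed_deriv :: "(fn \<Rightarrow> fn \<Rightarrow> fn \<Rightarrow> real) \<Rightarrow> fn \<Rightarrow> fn \<Rightarrow> fn \<Rightarrow> real" where
  "mixed_deriv c f g h =
     deriv (\<lambda>s. deriv (\<lambda>t. deriv (\<lambda>u.
       c (\<lambda>x. x - s * f x) (\<lambda>x. x - t * g x) (\<lambda>x. x - u * h x)) 0) 0) 0"

definition van_est_map :: "(fn \<Rightarrow> fn \<Rightarrow> fn \<Rightarrow> real) \<Rightarrow> fn \<Rightarrow> fn \<Rightarrow> fn \<Rightarrow> real" where
  "van_est_map c f g h =
     mixed_deriv c f g h + mixed_deriv c g h f + mixed_deriv c h f g
     - mixed_deriv c g f h - mixed_deriv c f h g - mixed_deriv c h g f"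

text \<open>The graph of the van Est isomorphism in degree 3: a continuous cohomology class of the
  group is mapped to the class of the derivative of a smooth cocycle representing it.\<close>

definition van_est_iso ::
  "((fn \<Rightarrow> fn \<Rightarrow> fn \<Rightarrow> real) set \<times> (fn \<Rightarrow> fn \<Rightarrow> fn \<Rightarrow> real) set) set" where
  "van_est_iso = {(K, Y). K \<in> grp_H3 diffZ diffZ_top \<and> Y \<in> lie_H3 \<and>
     (\<exists>c\<in>K. smooth_cochain3 c \<and> van_est_map c \<in> Y)}"

definition is_godbillon_vey_class :: "(fn \<Rightarrow> fn \<Rightarrow> fn \<Rightarrow> real) set \<Rightarrow> bool" where
  "is_godbillon_vey_class K \<longleftrightarrow> (K, lie_class theta0) \<in> van_est_iso"

end

(* Let B1_primitive(x,y) be the primitive of B1(x,y) vanishing at 0.  The section x -> (0,x) and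
   beta(x,y) = B1_primitive(x,y) o (xy)^{-1} give the cocycle c(x,y,z) = - B1_primitive(x,y)(z(0)), and any other
   continuous choice changes c by an explicit continuous coboundary.  Differentiating c at the identity
   along id - s f, id - t g, id - u h gives f'(0) g''(0) h(0), whose alternation is the determinant
   theta(0), on the nose and not only up to a coboundary.

   Continuity is reduced to finite-dimensional calculus: a map F from a space T into the Frechet space is
   continuous iff all x-derivatives of F(p)(x) are jointly continuous on T x R. *)
theory Submission
  imports Defs
begin

section \<open>Continuous families of smooth functions\<close>

text \<open>The real line matters: every 1-form on it has a primitive, given by a formula that
  depends continuously on the form, so continuous choices exist. The value at \<open>z(0)\<close> in
  the cocycle comes from an integration constant: the integrated cocycle identity of
  \<open>B1\<close> holds up to a constant, and at 0 every primitive in it vanishes except the one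
  moved by the third diffeomorphism.

  The main obstacle is that the van Est comparison asks for a smooth representative: iterated
  directional derivatives of every order must exist and be jointly continuous. Their formulas grow
  with the order, and composition makes the evaluation point move as well. The proof never writes
  them down. It isolates a class of integrands, \<open>admissible\<close>, that contains the
  integrand of the cocycle and is stable under differentiation along one further direction.
  Rescaling the primitive to an integral over the fixed interval \<open>{0..1}\<close> turns the
  variable endpoint into an ordinary ingredient of the integrand, so every order is reached by
  differentiating under the integral sign.\<close>

lemma continuous_map_real_iff:
  "continuous_map T euclideanreal f \<longleftrightarrow>
     (\<forall>x\<in>topspace T. \<forall>e>0. \<exists>U. openin T U \<and> x \<in> U \<and> (\<forall>y\<in>U. \<bar>f y - f x\<bar> < e))"
  (is "?L \<longleftrightarrow> ?R")
proof
  assume L: ?L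
  show ?R
  proof (intro ballI allI impI)
    fix x and e :: real assume x: "x \<in> topspace T" and e: "e > 0"
    have "openin T {y \<in> topspace T. f y \<in> ball (f x) e}"
      using L by (intro openin_continuous_map_preimage[where Y = euclideanreal]) auto
    then show "\<exists>U. openin T U \<and> x \<in> U \<and> (\<forall>y\<in>U. \<bar>f y - f x\<bar> < e)"
      using x e by (intro exI[of _ "{y \<in> topspace T. f y \<in> ball (f x) e}"])
        (auto simp: dist_real_def abs_minus_commute)
  qed
next
  assume R: ?R
  show ?L
    unfolding continuous_map_atin
  proof
    fix x assume x: "x \<in> topspace T"
    show "limitin euclideanreal f (f x) (atin T x)"
      unfolding limitin_canonical_iff tendsto_iff
    proof (intro allI impI)
      fix e :: real assume "e > 0"
      then obtain U where "openin T U" "x \<in> U" "\<forall>y\<in>U. \<bar>f y - f x\<bar> < e"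
        using R x by blast
      then show "eventually (\<lambda>y. dist (f y) (f x) < e) (atin T x)"
        unfolding eventually_atin dist_real_def by blast
    qed
  qed
qed

lemma continuous_map_compose_real:
  assumes "continuous_map T euclideanreal f" "continuous_on S g" "open S" "\<And>p. p \<in> topspace T \<Longrightarrow> f p \<in> S"
  shows "continuous_map T euclideanreal (\<lambda>p. g (f p))"
proof -
  have "continuous_map T (top_of_set S) f"
    using assms by (auto simp: continuous_map_in_subtopology)
  then show ?thesis
    using continuous_map_compose[of T "top_of_set S" f euclideanreal g] assms(2)
    by (simp add: o_def)
qed

text \<open>Tube lemma: the set where the difference is smaller than \<open>e\<close> is open and
  contains the slice over \<open>p\<close>, so by compactness of \<open>{a..b}\<close> it contains a
  whole product neighbourhood of that slice. The uniformity in \<open>t\<close> is what estimates of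
  integrals need.\<close>

lemma continuous_map_real_uniform:
  assumes h: "continuous_map (prod_topology T euclideanreal) euclideanreal (\<lambda>(p, t). h p t)"
    and p: "p \<in> topspace T" and e: "e > 0"
  obtains U where "openin T U" "p \<in> U" "\<And>q t. q \<in> U \<Longrightarrow> t \<in> {a..b} \<Longrightarrow> \<bar>h q t - h p t\<bar> < (e::real)"
proof -
  define W where "W = {z \<in> topspace (prod_topology T euclideanreal). (\<lambda>(q, t). h q t - h p t) z \<in> ball 0 e}"
  have hp: "continuous_map (prod_topology T euclideanreal) euclideanreal (\<lambda>z. (\<lambda>(p, t). h p t) (p, snd z))"
    using p by (intro continuous_map_compose[OF _ h, unfolded o_def] continuous_intros)
        (auto intro: continuous_intros)
  have "continuous_map (prod_topology T euclideanreal) euclideanreal (\<lambda>z. (\<lambda>(p, t). h p t) z - (\<lambda>(p, t). h p t) (p, snd z))"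
    by (intro continuous_map_diff h hp)
  then have "continuous_map (prod_topology T euclideanreal) euclideanreal (\<lambda>(q, t). h q t - h p t)"
    by (simp add: case_prod_beta')
  then have W: "openin (prod_topology T euclideanreal) W"
    unfolding W_def by (intro openin_continuous_map_preimage[where Y = euclideanreal]) auto
  obtain U V where "openin T U" "openin euclideanreal V" "{p} \<subseteq> U" "{a..b} \<subseteq> V" "U \<times> V \<subseteq> W"
    by (rule Wallace_theorem_prod_topology[of T "{p}" euclideanreal "{a..b}" W])
      (use p W e in \<open>auto simp: W_def\<close>)
  then show thesis
    by (intro that[of U]) (auto simp: W_def subset_eq dist_real_def)
qed

section \<open>Smooth functions and their Frechet topology\<close>

lemma deriv_pow_has_deriv:
  assumes "a \<in> smooth_fns"
  shows "((deriv ^^ n) a has_real_derivative (deriv ^^ Suc n) a x) (at x)"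
  using assms unfolding smooth_fns_def
  by (auto simp: differentiable_on_def DERIV_deriv_iff_real_differentiable)

lemma smooth_has_deriv:
  assumes "a \<in> smooth_fns"
  shows "(a has_real_derivative deriv a x) (at x)"
  using deriv_pow_has_deriv[OF assms, of 0 x] by simp

lemma smooth_deriv_pow: "a \<in> smooth_fns \<Longrightarrow> (deriv ^^ n) a \<in> smooth_fns"
  unfolding smooth_fns_def by (auto simp: funpow_add[unfolded o_def, THEN fun_cong, symmetric])

lemma smooth_deriv: "a \<in> smooth_fns \<Longrightarrow> deriv a \<in> smooth_fns"
  using smooth_deriv_pow[of a 1] by simp

lemma smooth_continuous: "a \<in> smooth_fns \<Longrightarrow> continuous_on A a"
  by (meson DERIV_isCont continuous_at_imp_continuous_on smooth_has_deriv)

lemma topspace_smooth_top [simp]: "topspace smooth_top = smooth_fns"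
proof -
  have "a \<in> smooth_ball 0 0 1 a" if "a \<in> smooth_fns" for a
    using that by (auto simp: smooth_ball_def)
  then have "smooth_fns \<subseteq> \<Union>{smooth_ball n r e a |n r e a. a \<in> smooth_fns \<and> 0 < e}"
    by (metis (mono_tags, lifting) CollectI UnionI subsetI zero_less_one)
  moreover have "\<Union>{smooth_ball n r e a |n r e a. a \<in> smooth_fns \<and> 0 < e} \<subseteq> smooth_fns"
    by (auto simp: smooth_ball_def)
  ultimately show ?thesis
    unfolding smooth_top_def topology_generated_by_topspace by (rule subset_antisym[rotated])
qed

lemma smooth_eval:
  "continuous_map (prod_topology smooth_top euclideanreal) euclideanreal (\<lambda>(a, x). (deriv ^^ k) a x)"
  unfolding continuous_map_real_iff
proof (intro ballI allI impI)
  fix z :: "fn \<times> real" and e :: real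
  assume z: "z \<in> topspace (prod_topology smooth_top euclideanreal)" and e: "e > 0"
  obtain a x where [simp]: "z = (a, x)" by (cases z)
  have a: "a \<in> smooth_fns" using z by simp
  have "isCont ((deriv ^^ k) a) x"
    using deriv_pow_has_deriv[OF a] DERIV_isCont by blast
  then obtain d where d: "d > 0" "\<And>y. \<bar>y - x\<bar> < d \<Longrightarrow> \<bar>(deriv ^^ k) a y - (deriv ^^ k) a x\<bar> < e / 2"
    using e unfolding continuous_at_eps_delta dist_real_def by (metis half_gt_zero)
  \<comment> \<open>The radius makes \<open>{-r..r}\<close> contain every \<open>y\<close> within
    \<open>d\<close> of \<open>x\<close>. One half of \<open>e\<close> pays for changing the
    function, the other for changing the point.\<close>
  define B where "B = smooth_ball k (\<bar>x\<bar> + d) (e / 2) a"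
  have "openin smooth_top B"
    unfolding smooth_top_def B_def using a e
    by (intro topology_generated_by_Basis CollectI exI[of _ k] exI[of _ "\<bar>x\<bar> + d"] exI[of _ "e / 2"] exI[of _ a]) simp
  then have "openin (prod_topology smooth_top euclideanreal) (B \<times> {x - d<..<x + d})"
    by (auto simp: openin_prod_Times_iff)
  moreover have "z \<in> B \<times> {x - d<..<x + d}"
    using a d e by (auto simp: B_def smooth_ball_def)
  moreover have "\<bar>(deriv ^^ k) b y - (deriv ^^ k) a x\<bar> < e" if "b \<in> B" "y \<in> {x - d<..<x + d}" for b y
  proof -
    have "y \<in> {- (\<bar>x\<bar> + d)..\<bar>x\<bar> + d}" using that by auto
    then have "\<bar>(deriv ^^ k) b y - (deriv ^^ k) a y\<bar> < e / 2"
      using that unfolding B_def smooth_ball_def by blast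
    moreover have "\<bar>(deriv ^^ k) a y - (deriv ^^ k) a x\<bar> < e / 2"
      using that d(2)[of y] by auto
    ultimately show ?thesis by linarith
  qed
  ultimately show "\<exists>U. openin (prod_topology smooth_top euclideanreal) U \<and> z \<in> U \<and>
      (\<forall>w\<in>U. \<bar>(case w of (a, x) \<Rightarrow> (deriv ^^ k) a x) - (case z of (a, x) \<Rightarrow> (deriv ^^ k) a x)\<bar> < e)"
    by (intro exI[of _ "B \<times> {x - d<..<x + d}"]) auto
qed

lemma continuous_map_eval_deriv:
  assumes "continuous_map T smooth_top F" "continuous_map T euclideanreal g"
  shows "continuous_map T euclideanreal (\<lambda>p. (deriv ^^ k) (F p) (g p))"
  using continuous_map_compose[OF continuous_map_pairedI[OF assms] smooth_eval[of k]]
  by (simp add: o_def)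

lemma continuous_map_eval:
  assumes "continuous_map T smooth_top F" "continuous_map T euclideanreal g"
  shows "continuous_map T euclideanreal (\<lambda>p. F p (g p))"
  using continuous_map_eval_deriv[OF assms, of 0] by simp

text \<open>A subbasic ball tests finitely many derivatives on one compact interval. Its centre
  \<open>a\<close> need not be \<open>F p\<close>, so the strict inequalities themselves are turned
  into an open subset of the product, and the tube lemma extracts a neighbourhood of
  \<open>p\<close>.\<close>

lemma continuous_map_smoothI:
  assumes sm: "\<And>p. p \<in> topspace T \<Longrightarrow> F p \<in> smooth_fns"
    and ct: "\<And>k. continuous_map (prod_topology T euclideanreal) euclideanreal (\<lambda>(p, x). (deriv ^^ k) (F p) x)"
  shows "continuous_map T smooth_top F"
  unfolding smooth_top_def
proof (rule continuous_on_generated_topo)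
  fix B assume "B \<in> {smooth_ball n r e a |n r e a. a \<in> smooth_fns \<and> 0 < e}"
  then obtain n r e a where B: "B = smooth_ball n r e a" and a: "a \<in> smooth_fns" and e: "e > 0" by blast
  have "\<exists>U. openin T U \<and> p \<in> U \<and> U \<subseteq> F -` B \<inter> topspace T" if p: "p \<in> F -` B \<inter> topspace T" for p
  proof -
    define W where "W = (\<Inter>k\<in>{..n}. {z \<in> topspace (prod_topology T euclideanreal).
        (\<lambda>(q, t). (deriv ^^ k) (F q) t - (deriv ^^ k) a t) z \<in> ball 0 e})"
    have "openin (prod_topology T euclideanreal) {z \<in> topspace (prod_topology T euclideanreal).
        (\<lambda>(q, t). (deriv ^^ k) (F q) t - (deriv ^^ k) a t) z \<in> ball 0 e}" for k
    proof -
      have 1: "continuous_map (prod_topology T euclideanreal) euclideanreal (\<lambda>z. (deriv ^^ k) a (snd z))"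
        by (rule continuous_map_eval_deriv) (auto intro: continuous_intros simp: a)
      have "continuous_map (prod_topology T euclideanreal) euclideanreal
          (\<lambda>z. (\<lambda>(q, t). (deriv ^^ k) (F q) t) z - (deriv ^^ k) a (snd z))"
        by (intro continuous_map_diff ct 1)
      then show ?thesis
        by (intro openin_continuous_map_preimage[where Y = euclideanreal]) (auto simp: case_prod_beta')
    qed
    then have W: "openin (prod_topology T euclideanreal) W"
      unfolding W_def by (intro openin_INT2) auto
    obtain U V where "openin T U" "openin euclideanreal V" "{p} \<subseteq> U" "{-r..r} \<subseteq> V" "U \<times> V \<subseteq> W"
      by (rule Wallace_theorem_prod_topology[of T "{p}" euclideanreal "{-r..r}" W])
        (use p W e in \<open>auto simp: W_def B smooth_ball_def dist_real_def abs_minus_commute\<close>)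
    moreover have "U \<subseteq> F -` B \<inter> topspace T"
    proof
      fix q assume q: "q \<in> U"
      then have "q \<in> topspace T" using \<open>openin T U\<close> openin_subset by blast
      moreover have "(q, t) \<in> W" if "t \<in> {-r..r}" for t
        using that q calculation \<open>U \<times> V \<subseteq> W\<close> \<open>{-r..r} \<subseteq> V\<close> by blast
      ultimately show "q \<in> F -` B \<inter> topspace T"
        using sm[of q] by (auto simp: B smooth_ball_def W_def dist_real_def abs_minus_commute)
    qed
    ultimately show ?thesis by blast
  qed
  then show "openin T (F -` B \<inter> topspace T)"
    by (subst openin_subopen) blast
next
  have "smooth_fns \<subseteq> \<Union>{smooth_ball n r e a |n r e a. a \<in> smooth_fns \<and> 0 < e}"
    using topspace_smooth_top unfolding smooth_top_def topology_generated_by_topspace by simp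
  then show "F ` topspace T \<subseteq> \<Union>{smooth_ball n r e a |n r e a. a \<in> smooth_fns \<and> 0 < e}"
    using sm by blast
qed


section \<open>Calculus of C^n families with parameters\<close>

abbreviation jointly_continuous :: "'p topology \<Rightarrow> ('p \<Rightarrow> real \<Rightarrow> real) \<Rightarrow> bool" where
  "jointly_continuous T h \<equiv>
     continuous_map (prod_topology T euclideanreal) euclideanreal (\<lambda>z. h (fst z) (snd z))"

text \<open>The derivative is an existential witness instead of \<open>deriv ^^ k\<close>. Closure
  under products, composition and inverses then goes by induction on \<open>n\<close>, using only
  first-order rules and no formula for higher derivatives of composites.\<close>

primrec Ck_family :: "'p topology \<Rightarrow> nat \<Rightarrow> ('p \<Rightarrow> real \<Rightarrow> real) \<Rightarrow> bool" where
  "Ck_family T 0 h \<longleftrightarrow> jointly_continuous T h"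
| "Ck_family T (Suc n) h \<longleftrightarrow> jointly_continuous T h \<and>
     (\<exists>h'. (\<forall>p\<in>topspace T. \<forall>x. (h p has_real_derivative h' p x) (at x)) \<and> Ck_family T n h')"

lemma Ck_SucI:
  assumes "jointly_continuous T h"
    and "\<And>p x. p \<in> topspace T \<Longrightarrow> (h p has_real_derivative h' p x) (at x)" "Ck_family T n h'"
  shows "Ck_family T (Suc n) h"
  using assms by auto

lemma Ck_jointly_continuous: "Ck_family T n h \<Longrightarrow> jointly_continuous T h"
  by (cases n) auto

lemma Ck_mono: "Ck_family T (Suc n) h \<Longrightarrow> Ck_family T n h"
proof (induction n arbitrary: h)
  case 0
  then show ?case by simp
next
  case (Suc n)
  from Suc.prems obtain h' where h': "jointly_continuous T h"
    "\<forall>p\<in>topspace T. \<forall>x. (h p has_real_derivative h' p x) (at x)" "Ck_family T (Suc n) h'"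
    unfolding Ck_family.simps(2)[of T "Suc n" h] by blast
  then show ?case
    unfolding Ck_family.simps(2)[of T n h] using Suc.IH by blast
qed

lemma Ck_cong:
  assumes "Ck_family T n h" "\<And>p. p \<in> topspace T \<Longrightarrow> h p = g p"
  shows "Ck_family T n g"
proof -
  have "jointly_continuous T g"
    using Ck_jointly_continuous[OF assms(1)] by (rule continuous_map_eq) (auto simp: assms(2))
  then show ?thesis
    using assms by (cases n) auto
qed

lemma Ck_deriv: 
  assumes "Ck_family T (Suc n) h"
  shows "Ck_family T n (\<lambda>p. deriv (h p))"
proof -
  obtain h' where h': "\<forall>p\<in>topspace T. \<forall>x. (h p has_real_derivative h' p x) (at x)" "Ck_family T n h'"
    using assms by auto
  \<comment> \<open>The witness is a derivative only for parameters in \<open>topspace T\<close>;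
    elsewhere it is arbitrary, which is why \<open>Ck_cong\<close> compares families on the space
    only.\<close>
  then have "deriv (h p) = h' p" if "p \<in> topspace T" for p
    using that by (intro ext DERIV_imp_deriv) blast
  then show ?thesis using Ck_cong[OF h'(2)] by metis
qed

lemma continuous_map_smooth_deriv:
  assumes "continuous_map T smooth_top F"
  shows "continuous_map T smooth_top (\<lambda>p. deriv (F p))"
proof (rule continuous_map_smoothI)
  show "deriv (F p) \<in> smooth_fns" if "p \<in> topspace T" for p
    using assms that continuous_map_image_subset_topspace[OF assms] by (intro smooth_deriv) auto
  show "continuous_map (prod_topology T euclideanreal) euclideanreal (\<lambda>(p, x). (deriv ^^ k) (deriv (F p)) x)" for k
    using continuous_map_eval_deriv[OF continuous_map_compose[OF continuous_map_fst assms] continuous_map_snd, where k = "Suc k"]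
    by (simp add: o_def case_prod_beta' funpow_swap1)
qed

text \<open>Forward, one derivative is peeled off at a time, because \<open>deriv\<close> preserves
  continuity into \<open>smooth_top\<close>. Conversely the \<open>k\<close>-th derivative costs
  \<open>k\<close> orders, which are available since all orders are assumed.\<close>

lemma continuous_map_smooth_iff:
  "continuous_map T smooth_top F \<longleftrightarrow> (\<forall>n. Ck_family T n F)"
proof
  assume "continuous_map T smooth_top F"
  then have "Ck_family T n F" for n
  proof (induction n arbitrary: F)
    case 0
    then show ?case
      using continuous_map_eval[OF continuous_map_compose[OF continuous_map_fst 0] continuous_map_snd]
      by (simp add: o_def)
  next
    case (Suc n)
    have "\<forall>p\<in>topspace T. \<forall>x. (F p has_real_derivative deriv (F p) x) (at x)"
      using Suc.prems continuous_map_image_subset_topspace[OF Suc.prems] by (intro ballI allI smooth_has_deriv) auto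
    moreover have "Ck_family T n (\<lambda>p. deriv (F p))"
      by (intro Suc.IH continuous_map_smooth_deriv Suc.prems)
    moreover have "jointly_continuous T F"
      using continuous_map_eval[OF continuous_map_compose[OF continuous_map_fst Suc.prems] continuous_map_snd]
      by (simp add: o_def)
    ultimately show ?case by (intro Ck_SucI) auto
  qed
  then show "\<forall>n. Ck_family T n F" ..
next
  assume F: "\<forall>n. Ck_family T n F"
  have D: "Ck_family T n (\<lambda>p. (deriv ^^ k) (F p))" for n k
  proof (induction k arbitrary: n)
    case 0
    then show ?case using F by simp
  next
    case (Suc k)
    show ?case using Ck_deriv[OF Suc.IH[of "Suc n"]] by simp
  qed
  show "continuous_map T smooth_top F"
  proof (rule continuous_map_smoothI)
    fix p assume p: "p \<in> topspace T"
    have "(deriv ^^ n) (F p) differentiable at x" for n x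
      using D[of 1 n] p by (auto simp: real_differentiable_def)
    then show "F p \<in> smooth_fns"
      by (simp add: smooth_fns_def differentiable_on_def)
  next
    fix k show "continuous_map (prod_topology T euclideanreal) euclideanreal (\<lambda>(p, x). (deriv ^^ k) (F p) x)"
      using Ck_jointly_continuous[OF D[of 0 k]] by (simp add: case_prod_beta')
  qed
qed

lemma jointly_continuous_comp:
  assumes "jointly_continuous T h" "jointly_continuous T g"
  shows "jointly_continuous T (\<lambda>p x. h p (g p x))"
  using continuous_map_compose[OF continuous_map_pairedI[OF continuous_map_fst assms(2)] assms(1)]
  by (simp add: o_def)

lemma Ck_const: "continuous_map T euclideanreal c \<Longrightarrow> Ck_family T n (\<lambda>p x. c p)"
proof (induction n arbitrary: c)
  case 0
  then show ?case
    using continuous_map_compose[OF continuous_map_fst 0] by (simp add: o_def)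
next
  case (Suc n)
  have "Ck_family T n (\<lambda>p x. 0)" by (intro Suc.IH) auto
  moreover have "\<forall>p\<in>topspace T. \<forall>x. ((\<lambda>x. c p) has_real_derivative 0) (at x)" by simp
  moreover have "jointly_continuous T (\<lambda>p x. c p)"
    using continuous_map_compose[OF continuous_map_fst Suc.prems] by (simp add: o_def)
  ultimately show ?case by (intro Ck_SucI) auto
qed

lemma Ck_ident: "Ck_family T n (\<lambda>p x. x)"
proof (cases n)
  case 0
  then show ?thesis by (simp add: continuous_map_snd)
next
  case (Suc m)
  have "Ck_family T m (\<lambda>p x. 1)" by (intro Ck_const) auto
  then show ?thesis unfolding Suc Ck_family.simps
    by (intro conjI exI[of _ "\<lambda>p x. 1"]) (auto intro: continuous_map_snd)
qed

lemma Ck_add: "Ck_family T n h \<Longrightarrow> Ck_family T n g \<Longrightarrow> Ck_family T n (\<lambda>p x. h p x + g p x)"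
proof (induction n arbitrary: h g)
  case 0
  then show ?case by (simp add: continuous_map_add)
next
  case (Suc n)
  obtain h' where h': "\<forall>p\<in>topspace T. \<forall>x. (h p has_real_derivative h' p x) (at x)" "Ck_family T n h'"
    using Suc.prems(1) by auto
  obtain g' where g': "\<forall>p\<in>topspace T. \<forall>x. (g p has_real_derivative g' p x) (at x)" "Ck_family T n g'"
    using Suc.prems(2) by auto
  have "\<forall>p\<in>topspace T. \<forall>x. ((\<lambda>x. h p x + g p x) has_real_derivative h' p x + g' p x) (at x)"
    using h'(1) g'(1) by (auto intro: DERIV_add)
  moreover have "Ck_family T n (\<lambda>p x. h' p x + g' p x)"
    by (intro Suc.IH h' g')
  moreover have "jointly_continuous T (\<lambda>p x. h p x + g p x)"
    using Suc.prems by (simp add: continuous_map_add)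
  ultimately show ?case by (auto intro!: exI[of _ "\<lambda>p x. h' p x + g' p x"])
qed

lemma Ck_mult: "Ck_family T n h \<Longrightarrow> Ck_family T n g \<Longrightarrow> Ck_family T n (\<lambda>p x. h p x * g p x)"
proof (induction n arbitrary: h g)
  case 0
  then show ?case by (simp add: continuous_map_real_mult)
next
  case (Suc n)
  obtain h' where h': "\<forall>p\<in>topspace T. \<forall>x. (h p has_real_derivative h' p x) (at x)" "Ck_family T n h'"
    using Suc.prems(1) by auto
  obtain g' where g': "\<forall>p\<in>topspace T. \<forall>x. (g p has_real_derivative g' p x) (at x)" "Ck_family T n g'"
    using Suc.prems(2) by auto
  have "\<forall>p\<in>topspace T. \<forall>x. ((\<lambda>x. h p x * g p x) has_real_derivative h' p x * g p x + g' p x * h p x) (at x)"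
    using h'(1) g'(1) by (auto intro!: DERIV_mult)
  moreover have "Ck_family T n (\<lambda>p x. h' p x * g p x + g' p x * h p x)"
    by (intro Ck_add Suc.IH h' g' Ck_mono[OF Suc.prems(1)] Ck_mono[OF Suc.prems(2)])
  moreover have "jointly_continuous T (\<lambda>p x. h p x * g p x)"
    using Suc.prems by (simp add: continuous_map_real_mult)
  ultimately show ?case by (auto intro!: exI[of _ "\<lambda>p x. h' p x * g p x + g' p x * h p x"])
qed

lemma Ck_comp: "Ck_family T n h \<Longrightarrow> Ck_family T n g \<Longrightarrow> Ck_family T n (\<lambda>p x. h p (g p x))"
proof (induction n arbitrary: h g)
  case 0
  then show ?case by (simp add: jointly_continuous_comp)
next
  case (Suc n)
  obtain h' where h': "\<forall>p\<in>topspace T. \<forall>x. (h p has_real_derivative h' p x) (at x)" "Ck_family T n h'"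
    using Suc.prems(1) by auto
  obtain g' where g': "\<forall>p\<in>topspace T. \<forall>x. (g p has_real_derivative g' p x) (at x)" "Ck_family T n g'"
    using Suc.prems(2) by auto
  have "\<forall>p\<in>topspace T. \<forall>x. ((\<lambda>x. h p (g p x)) has_real_derivative h' p (g p x) * g' p x) (at x)"
    by (intro ballI allI DERIV_chain2) (use h'(1) g'(1) in auto)
  moreover have "Ck_family T n (\<lambda>p x. h' p (g p x) * g' p x)"
    by (intro Ck_mult Suc.IH[OF h'(2) Ck_mono[OF Suc.prems(2)]] g'(2))
  moreover have "jointly_continuous T (\<lambda>p x. h p (g p x))"
    using Suc.prems by (simp add: jointly_continuous_comp)
  ultimately show ?case by (auto intro!: exI[of _ "\<lambda>p x. h' p (g p x) * g' p x"])
qed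

lemma Ck_inverse:
  assumes "\<And>p x. p \<in> topspace T \<Longrightarrow> h p x \<noteq> 0"
  shows "Ck_family T n h \<Longrightarrow> Ck_family T n (\<lambda>p x. inverse (h p x))"
proof (induction n)
  case 0
  then show ?case using assms by (auto intro: continuous_map_real_inverse)
next
  case (Suc n)
  obtain h' where h': "\<forall>p\<in>topspace T. \<forall>x. (h p has_real_derivative h' p x) (at x)" "Ck_family T n h'"
    using Suc.prems(1) by auto
  have "\<forall>p\<in>topspace T. \<forall>x. ((\<lambda>x. inverse (h p x)) has_real_derivative
      (- 1) * (inverse (h p x) * h' p x * inverse (h p x))) (at x)"
    using h'(1) assms by (auto intro!: derivative_eq_intros)
  moreover have "Ck_family T n (\<lambda>p x. (- 1) * (inverse (h p x) * h' p x * inverse (h p x)))"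
    by (intro Ck_mult Suc.IH h' Ck_mono[OF Suc.prems] Ck_const) auto
  moreover have "jointly_continuous T (\<lambda>p x. inverse (h p x))"
    using Suc.prems assms by (auto intro: continuous_map_real_inverse)
  ultimately show ?case
    by (auto intro!: exI[of _ "\<lambda>p x. (- 1) * (inverse (h p x) * h' p x * inverse (h p x))"])
qed

lemma Ck_ln:
  assumes pos: "\<And>p x. p \<in> topspace T \<Longrightarrow> h p x > 0" and h: "Ck_family T n h"
  shows "Ck_family T n (\<lambda>p x. ln (h p x))"
proof -
  have jc: "jointly_continuous T (\<lambda>p x. ln (h p x))"
    by (rule continuous_map_compose_real[OF Ck_jointly_continuous[OF h], of "{0<..}" ln])
      (use pos in \<open>auto intro: continuous_on_ln continuous_on_id\<close>)
  show ?thesis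
  proof (cases n)
    case 0
    then show ?thesis using jc by simp
  next
    case (Suc m)
    obtain h' where h': "\<forall>p\<in>topspace T. \<forall>x. (h p has_real_derivative h' p x) (at x)" "Ck_family T m h'"
      using h Suc by auto
    have "\<forall>p\<in>topspace T. \<forall>x. ((\<lambda>x. ln (h p x)) has_real_derivative inverse (h p x) * h' p x) (at x)"
      using h'(1) pos by (auto intro!: derivative_eq_intros simp: divide_inverse mult.commute)
    moreover have "Ck_family T m (\<lambda>p x. inverse (h p x) * h' p x)"
      using pos by (intro Ck_mult Ck_inverse h' Ck_mono[OF h[unfolded Suc]]) (auto simp: less_imp_neq[symmetric])
    ultimately show ?thesis using jc unfolding Suc Ck_family.simps
      by (intro conjI exI[of _ "\<lambda>p x. inverse (h p x) * h' p x"]) auto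
  qed
qed

section \<open>Integrals, primitives and inverse functions depending on parameters\<close>

lemma jointly_continuous_integral:
  assumes "jointly_continuous T h"
  shows "continuous_map T euclideanreal (\<lambda>p. integral {0..1} (h p))"
  unfolding continuous_map_real_iff
proof (intro ballI allI impI)
  fix p and e :: real assume p: "p \<in> topspace T" and e: "e > 0"
  have int: "h q integrable_on {0..1}" if "q \<in> topspace T" for q
  proof (rule integrable_continuous_real)
    have "continuous_map euclideanreal euclideanreal (\<lambda>x. h q x)"
      using continuous_map_compose[OF continuous_map_pairedI assms, of euclideanreal "\<lambda>_. q" id] that
      by (simp add: o_def)
    then show "continuous_on {0..1} (h q)"
      using continuous_on_subset by fastforce
  qed
  obtain U where U: "openin T U" "p \<in> U" "\<And>q t. q \<in> U \<Longrightarrow> t \<in> {0..1} \<Longrightarrow> \<bar>h q t - h p t\<bar> < e / 2"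
    using continuous_map_real_uniform[of T h p "e / 2" 0 1] assms p e by (auto simp: case_prod_beta')
  have "\<bar>integral {0..1} (h q) - integral {0..1} (h p)\<bar> < e" if q: "q \<in> U" for q
  proof -
    have qT: "q \<in> topspace T" using q U(1) openin_subset by blast
    have "norm (integral {0..1} (\<lambda>t. h q t - h p t)) \<le> integral {0..1} (\<lambda>t::real. e / 2)"
      by (rule integral_norm_bound_integral)
        (use int[OF qT] int[OF p] U(3)[OF q] in \<open>auto intro!: integrable_diff less_imp_le\<close>)
    then show ?thesis
      using int[OF qT] int[OF p] e by (simp add: integral_diff)
  qed
  then show "\<exists>U. openin T U \<and> p \<in> U \<and> (\<forall>q\<in>U. \<bar>integral {0..1} (h q) - integral {0..1} (h p)\<bar> < e)"
    using U by blast
qed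

text \<open>Writing \<open>\<integral>\<^sub>0\<^sup>t h\<close> as an integral over a fixed interval lets parameters, including \<open>t\<close>, be
  treated alike, and it makes sense for negative \<open>t\<close>.\<close>

definition antideriv :: "(real \<Rightarrow> real) \<Rightarrow> real \<Rightarrow> real" where
  "antideriv h t = t * integral {0..1} (\<lambda>r. h (r * t))"

lemma antideriv_0 [simp]: "antideriv h 0 = 0"
  by (simp add: antideriv_def)

text \<open>For a global antiderivative \<open>H\<close> of \<open>h\<close>, the function
  \<open>H (r * t)\<close> of \<open>r\<close> has derivative \<open>t * h (r * t)\<close>, so the
  scaled integral equals \<open>H t - H 0\<close> for either sign of \<open>t\<close>.\<close>

lemma antideriv_has_derivative:
  assumes "continuous_on UNIV h"
  shows "(antideriv h has_real_derivative h t) (at t)"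
proof -
  have "isCont h x" for x
    using assms by (simp add: continuous_on_eq_continuous_at)
  then obtain H where H: "\<And>x. (H has_vector_derivative h x) (at x)"
    using einterval_antiderivative[of "-\<infinity>" \<infinity> h] by auto
  have "antideriv h t = H t - H 0" for t
  proof -
    have "((\<lambda>r. H (r * t)) has_vector_derivative t * h (r * t)) (at r within {0..1})" for r
    proof -
      have "((\<lambda>r. H (r * t)) has_real_derivative h (r * t) * t) (at r)"
        using H by (intro DERIV_chain2[where f = H])
          (auto simp: has_real_derivative_iff_has_vector_derivative intro!: derivative_eq_intros)
      then show ?thesis
        by (simp add: has_real_derivative_iff_has_vector_derivative mult.commute
            has_vector_derivative_at_within)
    qed
    then have "((\<lambda>r. t * h (r * t)) has_integral H (1 * t) - H (0 * t)) {0..1}"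
      by (intro fundamental_theorem_of_calculus) auto
    then show ?thesis
      by (simp add: antideriv_def integral_unique flip: integral_mult_right)
  qed
  moreover have "((\<lambda>t. H t - H 0) has_real_derivative h t) (at t)"
    using H by (auto simp: has_real_derivative_iff_has_vector_derivative intro!: derivative_eq_intros)
  ultimately show ?thesis
    by (simp add: ext[of "antideriv h" "\<lambda>t. H t - H 0"])
qed

lemma jointly_continuous_slice:
  assumes "jointly_continuous T h" "p \<in> topspace T"
  shows "continuous_on A (h p)"
proof -
  have "continuous_map euclideanreal euclideanreal (\<lambda>x. h p x)"
    using continuous_map_compose[OF continuous_map_pairedI assms(1), of euclideanreal "\<lambda>_. p" id] assms(2)
    by (simp add: o_def)
  then show ?thesis
    using continuous_on_subset by fastforce
qed

text \<open>The derivative of the primitive is \<open>h p\<close> itself, so nothing is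
  differentiated under the integral sign: only joint continuity needs an argument, with
  \<open>t\<close> moved into the parameter space \<open>?T\<close>. The order gained by integrating
  is dropped at the end.\<close>

lemma Ck_antideriv:
  assumes "Ck_family T n h"
  shows "Ck_family T n (\<lambda>p. antideriv (h p))"
proof -
  let ?T = "prod_topology T euclideanreal"
  have 1: "jointly_continuous ?T (\<lambda>q r. h (fst q) (r * snd q))"
    using continuous_map_compose[OF _ Ck_jointly_continuous[OF assms],
        of "prod_topology ?T euclideanreal" "\<lambda>z. (fst (fst z), snd z * snd (fst z))"]
    by (simp add: o_def continuous_map_paired continuous_map_real_mult continuous_map_snd continuous_map_fst
      continuous_map_compose[OF continuous_map_fst continuous_map_fst, unfolded o_def]
      continuous_map_compose[OF continuous_map_fst continuous_map_snd, unfolded o_def])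
  have 2: "jointly_continuous T (\<lambda>p. antideriv (h p))"
    unfolding antideriv_def
    by (intro continuous_map_real_mult jointly_continuous_integral[OF 1] continuous_map_snd)
  have 3: "\<forall>p\<in>topspace T. \<forall>x. (antideriv (h p) has_real_derivative h p x) (at x)"
    using jointly_continuous_slice[OF Ck_jointly_continuous[OF assms]] antideriv_has_derivative by blast
  have "Ck_family T (Suc n) (\<lambda>p. antideriv (h p))"
    using assms 2 3 by auto
  then show ?thesis by (rule Ck_mono)
qed

lemma pos_deriv_strict_mono:
  fixes f :: "real \<Rightarrow> real"
  assumes "\<And>x. (f has_real_derivative f' x) (at x)" "\<And>x. f' x > 0"
  shows "strict_mono f"
proof (rule strict_monoI)
  fix x y :: real assume "x < y"
  then show "f x < f y"
    by (rule DERIV_pos_imp_increasing) (metis assms)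
qed

text \<open>Continuity of the inverse comes from monotonicity, which encloses a value of the inverse
  by two strict inequalities. The order is then bootstrapped: the derivative of the inverse is the
  reciprocal of \<open>deriv (h p)\<close> at the inverse, hence of order \<open>n\<close> as soon
  as the inverse is.\<close>

lemma Ck_inv:
  assumes h: "\<And>n. Ck_family T n h"
    and pos: "\<And>p x. p \<in> topspace T \<Longrightarrow> deriv (h p) x > 0"
    and bij: "\<And>p. p \<in> topspace T \<Longrightarrow> bij (h p)"
  shows "Ck_family T n (\<lambda>p. inv_into UNIV (h p))"
proof -
  have der: "(h p has_real_derivative deriv (h p) x) (at x)" if "p \<in> topspace T" for p x
    using h[of 1] that by (auto simp: DERIV_deriv_iff_real_differentiable real_differentiable_def)
  have mono: "strict_mono (h p)" if "p \<in> topspace T" for p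
    using pos_deriv_strict_mono[of "h p" "deriv (h p)"] der pos that by blast
  have hg: "h p (inv_into UNIV (h p) y) = y" "inv_into UNIV (h p) (h p y) = y" if "p \<in> topspace T" for p y
    using bij[OF that] by (auto simp: bij_is_surj surj_f_inv_f bij_is_inj)
  have cont: "jointly_continuous T (\<lambda>p. inv_into UNIV (h p))"
    unfolding continuous_map_real_iff
  proof (intro ballI allI impI)
    fix z :: "'a \<times> real" and e :: real
    assume z: "z \<in> topspace (prod_topology T euclideanreal)" and e: "e > 0"
    obtain p y where py: "z = (p, y)" "p \<in> topspace T" using z by (cases z) auto
    define x where "x = inv_into UNIV (h p) y"
    \<comment> \<open>For \<open>(q, v)\<close> in this set,
      \<open>h q (x - e) < v < h q (x + e)\<close>; strict monotonicity of \<open>h q\<close> places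
      the preimage of \<open>v\<close> within \<open>e\<close> of \<open>x\<close>.\<close>
    define U where "U = {w \<in> topspace (prod_topology T euclideanreal). h (fst w) (x - e) - snd w \<in> {..<0}}
      \<inter> {w \<in> topspace (prod_topology T euclideanreal). h (fst w) (x + e) - snd w \<in> {0<..}}"
    have ch: "continuous_map (prod_topology T euclideanreal) euclideanreal (\<lambda>w. h (fst w) a - snd w)" for a
    proof -
      have "continuous_map (prod_topology T euclideanreal) euclideanreal (\<lambda>w. h (fst w) a)"
        using continuous_map_compose[OF _ Ck_jointly_continuous[OF h[of 0]], of "prod_topology T euclideanreal" "\<lambda>w. (fst w, a)"]
        by (simp add: o_def continuous_map_paired continuous_map_fst)
      then show ?thesis by (intro continuous_map_diff continuous_map_snd)
    qed
    have "openin (prod_topology T euclideanreal) U"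
      unfolding U_def by (intro openin_Int openin_continuous_map_preimage[OF ch]) auto
    moreover have "z \<in> U"
    proof -
      have "h p (x - e) < y" "y < h p (x + e)"
        using strict_monoD[OF mono[OF py(2)], of "x - e" x] strict_monoD[OF mono[OF py(2)], of x "x + e"]
          e hg(1)[OF py(2), of y] by (simp_all add: x_def)
      then show ?thesis using py by (simp add: U_def)
    qed
    moreover have "\<bar>inv_into UNIV (h (fst w)) (snd w) - x\<bar> < e" if w: "w \<in> U" for w
    proof -
      obtain q v where [simp]: "w = (q, v)" by (cases w)
      have q: "q \<in> topspace T" using w by (auto simp: U_def)
      have "h q (x - e) < h q (inv_into UNIV (h q) v)" "h q (inv_into UNIV (h q) v) < h q (x + e)"
        using w by (auto simp: U_def hg[OF q])
      then show ?thesis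
        using strict_mono_less[OF mono[OF q]] by (auto simp: abs_less_iff)
    qed
    ultimately show "\<exists>U. openin (prod_topology T euclideanreal) U \<and> z \<in> U \<and>
      (\<forall>w\<in>U. \<bar>inv_into UNIV (h (fst w)) (snd w) - inv_into UNIV (h (fst z)) (snd z)\<bar> < e)"
      by (intro exI[of _ U]) (auto simp: py x_def)
  qed
  show ?thesis
  proof (induction n)
    case 0
    then show ?case using cont by simp
  next
    case (Suc n)
    let ?g' = "\<lambda>p y. inverse (deriv (h p) (inv_into UNIV (h p) y))"
    have "(inv_into UNIV (h p) has_real_derivative ?g' p y) (at y)" if p: "p \<in> topspace T" for p y
    proof (rule DERIV_inverse_function[where f = "h p" and a = "y - 1" and b = "y + 1"])
      show "isCont (inv_into UNIV (h p)) y"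
        using jointly_continuous_slice[OF cont p, of UNIV] by (simp add: continuous_on_eq_continuous_at)
      show "deriv (h p) (inv_into UNIV (h p) y) \<noteq> 0"
        using pos[OF p] by (metis less_irrefl)
    qed (use der hg p in auto)
    moreover have "Ck_family T n ?g'"
      by (rule Ck_inverse, use pos in \<open>simp add: less_imp_neq[symmetric]\<close>,
          rule Ck_comp[OF Ck_deriv[OF h] Suc.IH])
    ultimately show ?case
      using cont by (intro Ck_SucI)
  qed
qed

section \<open>Transfer to \<open>smooth_top\<close> and closure properties of
  \<open>smooth_fns\<close>\<close>

lemma smooth_family_add:
  "continuous_map T smooth_top F \<Longrightarrow> continuous_map T smooth_top G \<Longrightarrow>
   continuous_map T smooth_top (\<lambda>p x. F p x + G p x)"
  by (simp add: continuous_map_smooth_iff Ck_add)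

lemma smooth_family_mult:
  "continuous_map T smooth_top F \<Longrightarrow> continuous_map T smooth_top G \<Longrightarrow>
   continuous_map T smooth_top (\<lambda>p x. F p x * G p x)"
  by (simp add: continuous_map_smooth_iff Ck_mult)

lemma smooth_family_comp:
  "continuous_map T smooth_top F \<Longrightarrow> continuous_map T smooth_top G \<Longrightarrow>
   continuous_map T smooth_top (\<lambda>p x. F p (G p x))"
  by (simp add: continuous_map_smooth_iff Ck_comp)

lemma smooth_family_const:
  "continuous_map T euclideanreal c \<Longrightarrow> continuous_map T smooth_top (\<lambda>p x. c p)"
  by (simp add: continuous_map_smooth_iff Ck_const)

lemma smooth_family_ln:
  "continuous_map T smooth_top F \<Longrightarrow> (\<And>p x. p \<in> topspace T \<Longrightarrow> F p x > 0) \<Longrightarrow>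
   continuous_map T smooth_top (\<lambda>p x. ln (F p x))"
  by (simp add: continuous_map_smooth_iff Ck_ln)

lemma smooth_family_antideriv:
  "continuous_map T smooth_top F \<Longrightarrow> continuous_map T smooth_top (\<lambda>p. antideriv (F p))"
  by (simp add: continuous_map_smooth_iff Ck_antideriv)

lemma smooth_family_inv:
  assumes "continuous_map T smooth_top F"
    "\<And>p x. p \<in> topspace T \<Longrightarrow> deriv (F p) x > 0" "\<And>p. p \<in> topspace T \<Longrightarrow> bij (F p)"
  shows "continuous_map T smooth_top (\<lambda>p. inv_into UNIV (F p))"
  using assms Ck_inv[of T F] by (simp add: continuous_map_smooth_iff)

text \<open>Over a one-point parameter space continuity says only that the value lies in
  \<open>smooth_fns\<close>. Each continuity lemma above thereby yields the matching closure
  property of smooth functions.\<close>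

lemma smooth_iff_family: "a \<in> smooth_fns \<longleftrightarrow> continuous_map (discrete_topology {()}) smooth_top (\<lambda>_. a)"
  by (simp flip: null_topspace_iff_trivial)

lemma smooth_add: "a \<in> smooth_fns \<Longrightarrow> b \<in> smooth_fns \<Longrightarrow> (\<lambda>x. a x + b x) \<in> smooth_fns"
  unfolding smooth_iff_family by (rule smooth_family_add)

lemma smooth_mult: "a \<in> smooth_fns \<Longrightarrow> b \<in> smooth_fns \<Longrightarrow> (\<lambda>x. a x * b x) \<in> smooth_fns"
  unfolding smooth_iff_family by (rule smooth_family_mult)

lemma smooth_comp: "a \<in> smooth_fns \<Longrightarrow> b \<in> smooth_fns \<Longrightarrow> (\<lambda>x. a (b x)) \<in> smooth_fns"
  unfolding smooth_iff_family by (rule smooth_family_comp)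

lemma smooth_const: "(\<lambda>x. c) \<in> smooth_fns"
  unfolding smooth_iff_family by (rule smooth_family_const) simp

lemma smooth_ident: "(\<lambda>x. x) \<in> smooth_fns"
  unfolding smooth_iff_family by (simp only: continuous_map_smooth_iff Ck_ident simp_thms)

lemma smooth_minus: "a \<in> smooth_fns \<Longrightarrow> (\<lambda>x. - a x) \<in> smooth_fns"
  using smooth_mult[OF smooth_const[of "- 1"]] by simp

lemma smooth_scale: "a \<in> smooth_fns \<Longrightarrow> (\<lambda>x. c * a x) \<in> smooth_fns"
  using smooth_mult[OF smooth_const] by simp

lemma smooth_ln: "a \<in> smooth_fns \<Longrightarrow> (\<And>x. a x > 0) \<Longrightarrow> (\<lambda>x. ln (a x)) \<in> smooth_fns"
  unfolding smooth_iff_family by (rule smooth_family_ln)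

lemma smooth_antideriv: "a \<in> smooth_fns \<Longrightarrow> antideriv a \<in> smooth_fns"
  unfolding smooth_iff_family by (rule smooth_family_antideriv)

lemma smooth_inv: "a \<in> smooth_fns \<Longrightarrow> (\<And>x. deriv a x > 0) \<Longrightarrow> bij a \<Longrightarrow> inv_into UNIV a \<in> smooth_fns"
  unfolding smooth_iff_family by (rule smooth_family_inv)

lemma deriv_antideriv: "a \<in> smooth_fns \<Longrightarrow> deriv (antideriv a) = a"
  by (intro ext DERIV_imp_deriv antideriv_has_derivative smooth_continuous)

lemma smooth_deriv_comp:
  assumes "a \<in> smooth_fns" "b \<in> smooth_fns"
  shows "deriv (\<lambda>x. a (b x)) = (\<lambda>x. deriv a (b x) * deriv b x)"
  by (intro ext DERIV_imp_deriv DERIV_chain2 smooth_has_deriv assms)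

lemma smooth_deriv_add:
  assumes "a \<in> smooth_fns" "b \<in> smooth_fns"
  shows "deriv (\<lambda>x. a x + b x) = (\<lambda>x. deriv a x + deriv b x)"
  by (intro ext DERIV_imp_deriv DERIV_add smooth_has_deriv assms)

lemma smooth_deriv_mult:
  assumes "a \<in> smooth_fns" "b \<in> smooth_fns"
  shows "deriv (\<lambda>x. a x * b x) = (\<lambda>x. deriv a x * b x + deriv b x * a x)"
  by (intro ext DERIV_imp_deriv DERIV_mult smooth_has_deriv assms)

lemma smooth_deriv_scale:
  assumes "a \<in> smooth_fns"
  shows "deriv (\<lambda>x. c * a x) = (\<lambda>x. c * deriv a x)"
  by (intro ext DERIV_imp_deriv DERIV_cmult smooth_has_deriv assms)

text \<open>Identities between 1-forms are integrated through this lemma; with \<open>y = 0\<close>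
  the terms given by \<open>antideriv\<close> drop out.\<close>

lemma smooth_diff_eqI:
  assumes "a \<in> smooth_fns" "b \<in> smooth_fns" "deriv a = deriv b"
  shows "a x - a y = b x - b y"
proof -
  have "((\<lambda>x. a x - b x) has_real_derivative 0) (at x)" for x
    using DERIV_diff[OF smooth_has_deriv[OF assms(1)] smooth_has_deriv[OF assms(2)], of x] assms(3)
    by simp
  then have "a x - b x = a y - b y" by (intro DERIV_isconst_all) blast
  then show ?thesis by simp
qed

section \<open>The crossed module\<close>

lemma quasi_periodic_int:
  fixes g :: "real \<Rightarrow> real"
  assumes "\<And>x. g (x + 1) = g x + c"
  shows "g (x + of_int n) = g x + of_int n * c"
proof (induction n rule: int_induct[where k = 0])
  case base
  show ?case by simp
next
  case (step1 i)
  then show ?case using assms[of "x + of_int i"] by (simp add: algebra_simps)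
next
  case (step2 i)
  then show ?case using assms[of "x + of_int (i - 1)"] by (simp add: algebra_simps)
qed

text \<open>The remaining conditions of \<open>diffZ\<close> follow: positivity of the derivative
  gives injectivity, equivariance makes \<Phi> unbounded in both directions and hence surjective by
  the intermediate value theorem, and \<open>smooth_inv\<close> gives the smooth inverse.\<close>

lemma diffZI:
  assumes s: "\<Phi> \<in> smooth_fns" and pos: "\<And>x. deriv \<Phi> x > 0" and eq: "\<And>x. \<Phi> (x + 1) = \<Phi> x + 1"
  shows "\<Phi> \<in> carrier diffZ"
proof -
  have eqn: "\<Phi> (x + of_int n) = \<Phi> x + of_int n" for x n
    using quasi_periodic_int[of \<Phi> 1 x n] eq by simp
  have "strict_mono \<Phi>"
    using pos_deriv_strict_mono[of \<Phi> "deriv \<Phi>"] smooth_has_deriv[OF s] pos by blast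
  then have "inj \<Phi>" by (rule strict_mono_imp_inj_on)
  moreover have "\<exists>x. \<Phi> x = y" for y
  proof -
    obtain n :: int where n: "\<bar>y - \<Phi> 0\<bar> \<le> of_int n" using ex_le_of_int by blast
    have "\<exists>x. 0 - of_int n \<le> x \<and> x \<le> 0 + of_int n \<and> \<Phi> x = y"
      by (rule IVT') (use n eqn[of 0 n] eqn[of 0 "- n"] smooth_continuous[OF s] in \<open>auto simp: abs_le_iff\<close>)
    then show ?thesis by blast
  qed
  ultimately have "bij \<Phi>"
    unfolding bij_def surj_def by metis
  then show ?thesis
    using s pos eqn smooth_inv[OF s pos] by (simp add: diffZ_def)
qed

lemma diffZD:
  assumes "\<Phi> \<in> carrier diffZ"
  shows "\<Phi> \<in> smooth_fns" "deriv \<Phi> x > 0" "bij \<Phi>" "\<Phi> (x + 1) = \<Phi> x + 1"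
proof -
  show "\<Phi> (x + 1) = \<Phi> x + 1"
    using assms unfolding diffZ_def by simp (metis of_int_1)
qed (use assms in \<open>auto simp: diffZ_def\<close>)

lemma diffZ_inv_simps:
  assumes "\<Phi> \<in> carrier diffZ"
  shows "\<Phi> (inv_into UNIV \<Phi> x) = x" "inv_into UNIV \<Phi> (\<Phi> x) = x"
  using diffZD(3)[OF assms] by (simp_all add: bij_is_surj surj_f_inv_f bij_is_inj)

lemma diffZ_id: "id \<in> carrier diffZ"
  by (rule diffZI) (auto simp: id_def smooth_ident)

lemma diffZ_comp:
  assumes "\<Phi> \<in> carrier diffZ" "\<Psi> \<in> carrier diffZ"
  shows "\<Phi> \<circ> \<Psi> \<in> carrier diffZ"
  unfolding o_def
  by (rule diffZI)
    (use assms in \<open>auto simp: diffZD smooth_comp smooth_deriv_comp\<close>)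

lemma diffZ_inv:
  assumes P: "\<Phi> \<in> carrier diffZ"
  shows "inv_into UNIV \<Phi> \<in> carrier diffZ"
proof (rule diffZI)
  let ?g = "inv_into UNIV \<Phi>"
  show s: "?g \<in> smooth_fns"
    by (rule smooth_inv) (use diffZD[OF P] in auto)
  fix x
  have "deriv (\<lambda>x. \<Phi> (?g x)) x = 1"
    by (simp add: diffZ_inv_simps[OF P])
  then have "deriv \<Phi> (?g x) * deriv ?g x = 1"
    by (simp add: smooth_deriv_comp[OF diffZD(1)[OF P] s])
  then show "deriv ?g x > 0"
    using diffZD(2)[OF P, of "?g x"] by (metis zero_less_mult_pos zero_less_one)
  have "\<Phi> (?g (x + 1)) = \<Phi> (?g x + 1)"
    by (simp add: diffZ_inv_simps[OF P] diffZD(4)[OF P])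
  then show "?g (x + 1) = ?g x + 1"
    by (metis diffZ_inv_simps(2)[OF P])
qed

lemma diffZ_simps [simp]:
  "mult diffZ \<Phi> \<Psi> = \<Phi> \<circ> \<Psi>" "one diffZ = id"
  by (simp_all add: diffZ_def)

lemma group_diffZ: "group diffZ"
proof (rule groupI)
  fix \<Phi> assume "\<Phi> \<in> carrier diffZ"
  then show "\<exists>\<Psi>\<in>carrier diffZ. \<Psi> \<otimes>\<^bsub>diffZ\<^esub> \<Phi> = \<one>\<^bsub>diffZ\<^esub>"
    by (intro bexI[of _ "inv_into UNIV \<Phi>"] diffZ_inv) (auto simp: diffZ_inv_simps)
qed (auto simp: diffZ_comp diffZ_id)

section \<open>The logarithmic derivative and the cocycle \<open>B1\<close>\<close>

lemma log_deriv_smooth: "\<Phi> \<in> carrier diffZ \<Longrightarrow> log_deriv \<Phi> \<in> smooth_fns"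
  unfolding log_deriv_def by (intro smooth_ln smooth_deriv diffZD)

lemma log_deriv_comp:
  assumes "\<Phi> \<in> carrier diffZ" "\<Psi> \<in> carrier diffZ"
  shows "log_deriv (\<Phi> \<circ> \<Psi>) = (\<lambda>x. log_deriv \<Phi> (\<Psi> x) + log_deriv \<Psi> x)"
  using assms by (auto simp: log_deriv_def o_def smooth_deriv_comp diffZD ln_mult_pos)

lemma B1_smooth: "\<Phi> \<in> carrier diffZ \<Longrightarrow> \<Psi> \<in> carrier diffZ \<Longrightarrow> B1 \<Phi> \<Psi> \<in> smooth_fns"
  unfolding B1_def pullback0_def
  by (rule smooth_mult[OF smooth_comp[OF log_deriv_smooth diffZD(1)] smooth_deriv[OF log_deriv_smooth]])

text \<open>By the chain rule \<open>log_deriv\<close> is a 1-cocycle with values in functions, its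
  differential is one with values in 1-forms, and \<open>B1\<close> is their cup product. Both sides
  expand to the same three terms.\<close>

lemma B1_cocycle:
  assumes "\<Phi> \<in> carrier diffZ" "\<Psi> \<in> carrier diffZ" "\<Xi> \<in> carrier diffZ"
  shows "pullback1 \<Xi> (B1 \<Phi> \<Psi>) x + B1 (\<Phi> \<circ> \<Psi>) \<Xi> x = B1 \<Psi> \<Xi> x + B1 \<Phi> (\<Psi> \<circ> \<Xi>) x"
proof -
  have "deriv (log_deriv (\<Psi> \<circ> \<Xi>)) x = deriv (log_deriv \<Psi>) (\<Xi> x) * deriv \<Xi> x + deriv (log_deriv \<Xi>) x"
    using assms by (simp add: log_deriv_comp smooth_deriv_add smooth_deriv_comp smooth_comp log_deriv_smooth diffZD)
  then show ?thesis
    using assms by (simp add: B1_def pullback0_def pullback1_def log_deriv_comp algebra_simps)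
qed

lemma log_deriv_id [simp]: "log_deriv id = (\<lambda>x. 0)"
  by (simp add: log_deriv_def id_def)

lemma B1_id [simp]: "B1 id \<Psi> = (\<lambda>x. 0)" "B1 \<Phi> id = (\<lambda>x. 0)"
  by (simp_all add: B1_def pullback0_def)

lemma pullback1_id [simp]: "pullback1 id a = a"
  by (simp add: pullback1_def id_def)

lemma pullback1_smooth: "\<Psi> \<in> carrier diffZ \<Longrightarrow> a \<in> smooth_fns \<Longrightarrow> pullback1 \<Psi> a \<in> smooth_fns"
  unfolding pullback1_def by (rule smooth_mult[OF smooth_comp[OF _ diffZD(1)] smooth_deriv[OF diffZD(1)]])

lemma pullback1_comp:
  assumes "\<Phi> \<in> carrier diffZ" "\<Psi> \<in> carrier diffZ"
  shows "pullback1 (\<Phi> \<circ> \<Psi>) a = pullback1 \<Psi> (pullback1 \<Phi> a)"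
  using assms by (auto simp: pullback1_def o_def smooth_deriv_comp diffZD)

lemma pullback1_deriv:
  assumes "\<Phi> \<in> carrier diffZ" "a \<in> smooth_fns"
  shows "pullback1 \<Phi> (deriv a) = deriv (\<lambda>x. a (\<Phi> x))"
  using assms by (simp add: pullback1_def smooth_deriv_comp diffZD)

section \<open>The extension by 1-forms and the exact sequence\<close>

lemma F1_ext_simps [simp]:
  "carrier F1_ext = smooth_fns \<times> carrier diffZ" "one F1_ext = (\<lambda>x. 0, id)"
  "mult F1_ext (a, \<Phi>) (b, \<Psi>) = (\<lambda>x. pullback1 \<Psi> a x + b x + B1 \<Phi> \<Psi> x, \<Phi> \<circ> \<Psi>)"
  by (simp_all add: F1_ext_def)

text \<open>Associativity is the cocycle identity of \<open>B1\<close> combined with functoriality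
  of the pull-back.\<close>

lemma group_F1_ext: "group F1_ext"
proof (rule groupI)
  fix n m assume "n \<in> carrier F1_ext" "m \<in> carrier F1_ext"
  then show "n \<otimes>\<^bsub>F1_ext\<^esub> m \<in> carrier F1_ext"
    by (cases n; cases m) (auto intro!: smooth_add pullback1_smooth B1_smooth diffZ_comp)
next
  show "\<one>\<^bsub>F1_ext\<^esub> \<in> carrier F1_ext"
    by (simp add: smooth_const diffZ_id)
next
  fix n m l assume *: "n \<in> carrier F1_ext" "m \<in> carrier F1_ext" "l \<in> carrier F1_ext"
  obtain a \<Phi> b \<Psi> c \<Xi> where n: "n = (a, \<Phi>)" "m = (b, \<Psi>)" "l = (c, \<Xi>)"
    by (cases n; cases m; cases l) auto
  have c: "\<Phi> \<in> carrier diffZ" "\<Psi> \<in> carrier diffZ" "\<Xi> \<in> carrier diffZ"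
    using * by (auto simp: n)
  have "pullback1 \<Xi> (\<lambda>x. pullback1 \<Psi> a x + b x + B1 \<Phi> \<Psi> x) x + c x + B1 (\<Phi> \<circ> \<Psi>) \<Xi> x
    = pullback1 (\<Psi> \<circ> \<Xi>) a x + (pullback1 \<Xi> b x + c x + B1 \<Psi> \<Xi> x) + B1 \<Phi> (\<Psi> \<circ> \<Xi>) x" for x
    using B1_cocycle[OF c, of x] pullback1_comp[OF c(2,3), of a]
    by (simp add: pullback1_def algebra_simps)
  then show "n \<otimes>\<^bsub>F1_ext\<^esub> m \<otimes>\<^bsub>F1_ext\<^esub> l = n \<otimes>\<^bsub>F1_ext\<^esub> (m \<otimes>\<^bsub>F1_ext\<^esub> l)"
    by (simp only: n F1_ext_simps comp_assoc)
next
  fix n assume "n \<in> carrier F1_ext"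
  then show "\<one>\<^bsub>F1_ext\<^esub> \<otimes>\<^bsub>F1_ext\<^esub> n = n"
    by (cases n) (simp add: pullback1_def)
next
  fix n assume *: "n \<in> carrier F1_ext"
  obtain a \<Phi> where [simp]: "n = (a, \<Phi>)" by (cases n)
  have P: "\<Phi> \<in> carrier diffZ" "a \<in> smooth_fns" using * by auto
  define \<Psi> where "\<Psi> = inv_into UNIV \<Phi>"
  have Q: "\<Psi> \<in> carrier diffZ" unfolding \<Psi>_def by (rule diffZ_inv[OF P(1)])
  have [simp]: "\<Psi> \<circ> \<Phi> = id" by (auto simp: \<Psi>_def diffZ_inv_simps[OF P(1)])
  \<comment> \<open>Solves \<open>pullback1 \<Phi> b + a + B1 \<Psi> \<Phi> = 0\<close> for
    \<open>b\<close>: pulling back along \<Psi> undoes the pull-back along \<Phi>.\<close>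
  define b where "b = pullback1 \<Psi> (\<lambda>x. - (a x + B1 \<Psi> \<Phi> x))"
  have "b \<in> smooth_fns"
    unfolding b_def by (intro pullback1_smooth smooth_minus smooth_add B1_smooth P Q)
  moreover have "pullback1 \<Phi> b = (\<lambda>x. - (a x + B1 \<Psi> \<Phi> x))"
    using pullback1_comp[OF Q P(1), of "\<lambda>x. - (a x + B1 \<Psi> \<Phi> x)"] by (simp add: b_def)
  ultimately show "\<exists>m\<in>carrier F1_ext. m \<otimes>\<^bsub>F1_ext\<^esub> n = \<one>\<^bsub>F1_ext\<^esub>"
    using Q by (intro bexI[of _ "(b, \<Psi>)"]) auto
qed

lemma F0_simps [simp]:
  "carrier F0 = smooth_fns" "mult F0 a b = (\<lambda>x. a x + b x)" "one F0 = (\<lambda>x. 0)"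
  by (simp_all add: F0_def)

lemma group_F0: "group F0"
proof (rule groupI)
  fix a assume "a \<in> carrier F0"
  then show "\<exists>b\<in>carrier F0. b \<otimes>\<^bsub>F0\<^esub> a = \<one>\<^bsub>F0\<^esub>"
    by (intro bexI[of _ "\<lambda>x. - a x"]) (auto simp: smooth_minus)
qed (auto simp: smooth_add smooth_const add.assoc)

lemma F0_inv: "a \<in> smooth_fns \<Longrightarrow> m_inv F0 a = (\<lambda>x. - a x)"
  using group.inv_equality[OF group_F0, of "\<lambda>x. - a x" a] by (simp add: smooth_minus)

lemma F1_ext_act_smooth:
  "n \<in> carrier F1_ext \<Longrightarrow> a \<in> smooth_fns \<Longrightarrow> F1_ext_act n a \<in> smooth_fns"
  by (cases n) (auto simp: F1_ext_act_def pullback0_def intro: smooth_comp diffZ_inv diffZD)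

lemma F1_ext_act_hom: "(\<lambda>n. \<lambda>a\<in>carrier F0. F1_ext_act n a) \<in> hom F1_ext (AutoGroup F0)"
proof -
  let ?f = "\<lambda>n. \<lambda>a\<in>carrier F0. F1_ext_act n a"
  have au: "?f n \<in> auto F0" if n: "n \<in> carrier F1_ext" for n
  proof -
    obtain b \<Phi> where [simp]: "n = (b, \<Phi>)" by (cases n)
    have P: "\<Phi> \<in> carrier diffZ" using n by simp
    have "?f n \<in> hom F0 F0"
      using F1_ext_act_smooth[OF n] by (auto simp: hom_def smooth_add F1_ext_act_def pullback0_def)
    moreover have "bij_betw (?f n) (carrier F0) (carrier F0)"
    proof (rule bij_betw_byWitness[where f' = "\<lambda>a x. a (\<Phi> x)"])
      show "?f n ` carrier F0 \<subseteq> carrier F0" using F1_ext_act_smooth[OF n] by auto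
      show "(\<lambda>a x. a (\<Phi> x)) ` carrier F0 \<subseteq> carrier F0"
        using smooth_comp diffZD(1)[OF P] by auto
      show "\<forall>a\<in>carrier F0. (\<lambda>x. ?f n a (\<Phi> x)) = a"
        by (auto simp: F1_ext_act_def pullback0_def diffZ_inv_simps[OF P])
      show "\<forall>a\<in>carrier F0. ?f n (\<lambda>x. a (\<Phi> x)) = a"
        using smooth_comp[OF _ diffZD(1)[OF P]]
        by (auto simp: F1_ext_act_def pullback0_def diffZ_inv_simps[OF P])
    qed
    ultimately show ?thesis by (simp add: auto_def Bij_def)
  qed
  show ?thesis
  proof (rule homI)
    fix n assume "n \<in> carrier F1_ext"
    then show "?f n \<in> carrier (AutoGroup F0)" using au by (simp add: AutoGroup_def)
  next
    fix n m assume n: "n \<in> carrier F1_ext" and m: "m \<in> carrier F1_ext"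
    obtain a \<Phi> b \<Psi> where [simp]: "n = (a, \<Phi>)" "m = (b, \<Psi>)" by (cases n; cases m)
    have P: "\<Phi> \<in> carrier diffZ" "\<Psi> \<in> carrier diffZ" using n m by auto
    have "inv_into UNIV (\<Phi> \<circ> \<Psi>) = inv_into UNIV \<Psi> \<circ> inv_into UNIV \<Phi>"
      using P by (intro o_inv_distrib diffZD)
    then have "F1_ext_act (n \<otimes>\<^bsub>F1_ext\<^esub> m) c = F1_ext_act n (F1_ext_act m c)" for c
      by (simp add: F1_ext_act_def pullback0_def)
    then have "?f (n \<otimes>\<^bsub>F1_ext\<^esub> m) = compose (carrier F0) (?f n) (?f m)"
      using F1_ext_act_smooth[OF m] by (auto simp: compose_def)
    then show "?f (n \<otimes>\<^bsub>F1_ext\<^esub> m) = ?f n \<otimes>\<^bsub>AutoGroup F0\<^esub> ?f m"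
      using au[OF n] au[OF m] by (simp add: AutoGroup_def BijGroup_def auto_def)
  qed
qed

lemma mu_hom: "mu \<in> hom F0 F1_ext"
  by (rule homI) (auto simp: mu_def smooth_deriv diffZ_id smooth_deriv_add)

lemma F1_ext_crossed_module: "crossed_module F0 F1_ext mu F1_ext_act"
  unfolding crossed_module_def
proof (intro conjI ballI group_F0 group_F1_ext mu_hom F1_ext_act_hom)
  fix n a assume n: "n \<in> carrier F1_ext" and a: "a \<in> carrier F0"
  obtain b \<Phi> where [simp]: "n = (b, \<Phi>)" by (cases n)
  have P: "\<Phi> \<in> carrier diffZ" using n by simp
  have sm: "F1_ext_act n a \<in> smooth_fns" using F1_ext_act_smooth n a by simp
  have "pullback1 \<Phi> (deriv (F1_ext_act n a)) = deriv a"
    using pullback1_deriv[OF P sm] by (simp add: F1_ext_act_def pullback0_def diffZ_inv_simps[OF P])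
  \<comment> \<open>Equivariance is first proved in this multiplied form, which needs no formula for
    inverses in \<open>F1_ext\<close>. In both products one factor lies over \<open>id\<close>, so
    \<open>B1\<close> contributes nothing.\<close>
  then have "n \<otimes>\<^bsub>F1_ext\<^esub> mu a = mu (F1_ext_act n a) \<otimes>\<^bsub>F1_ext\<^esub> n"
    by (simp add: mu_def add.commute)
  moreover have "mu c \<in> carrier F1_ext" if "c \<in> smooth_fns" for c
    using hom_in_carrier[OF mu_hom, of c] that by simp
  ultimately show "mu (F1_ext_act n a) = n \<otimes>\<^bsub>F1_ext\<^esub> mu a \<otimes>\<^bsub>F1_ext\<^esub> inv\<^bsub>F1_ext\<^esub> n"
    using group.inv_solve_right[OF group_F1_ext, of "mu (F1_ext_act n a)" "n \<otimes>\<^bsub>F1_ext\<^esub> mu a" n]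
      n a sm group.is_monoid[OF group_F1_ext, THEN monoid.m_closed, of n "mu a"] by simp
next
  fix a b assume "a \<in> carrier F0" "b \<in> carrier F0"
  then show "F1_ext_act (mu a) b = a \<otimes>\<^bsub>F0\<^esub> b \<otimes>\<^bsub>F0\<^esub> inv\<^bsub>F0\<^esub> a"
    by (simp add: F1_ext_act_def mu_def pullback0_def F0_inv)
qed

text \<open>Exactness at \<open>F1_ext\<close> is the Poincare lemma on the line, with
  \<open>antideriv\<close> supplying the primitive; exactness at \<open>F0\<close> says that a
  function with zero differential is constant.\<close>

lemma F1_ext_crossed_module_seq: "crossed_module_seq real_grp const_fn F0 mu F1_ext snd diffZ F1_ext_act"
  unfolding crossed_module_seq_def
proof (intro conjI ballI F1_ext_crossed_module group_diffZ)
  show "group real_grp"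
  proof (rule groupI)
    fix x assume "x \<in> carrier real_grp"
    show "\<exists>y\<in>carrier real_grp. y \<otimes>\<^bsub>real_grp\<^esub> x = \<one>\<^bsub>real_grp\<^esub>"
      by (intro bexI[of _ "- x"]) (auto simp: real_grp_def)
  qed (auto simp: real_grp_def)
  show "const_fn \<in> hom real_grp F0"
    by (auto simp: hom_def const_fn_def smooth_const real_grp_def)
  show "inj_on const_fn (carrier real_grp)"
    by (auto simp: inj_on_def const_fn_def dest: fun_cong)
  show "const_fn ` carrier real_grp = kernel F0 F1_ext mu"
  proof (intro subset_antisym subsetI)
    fix a assume "a \<in> const_fn ` carrier real_grp"
    then show "a \<in> kernel F0 F1_ext mu"
      by (auto simp: kernel_def const_fn_def mu_def smooth_const)
  next
    fix a assume "a \<in> kernel F0 F1_ext mu"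
    then have "a \<in> smooth_fns" "deriv a = deriv (\<lambda>x. 0)" by (auto simp: kernel_def mu_def)
    then have "a = const_fn (a 0)"
      using smooth_diff_eqI[of a "\<lambda>x. 0" _ 0] by (auto simp: const_fn_def smooth_const)
    then show "a \<in> const_fn ` carrier real_grp" by (auto simp: real_grp_def)
  qed
  show "snd \<in> hom F1_ext diffZ" by (auto simp: hom_def)
  show "mu ` carrier F0 = kernel F1_ext diffZ snd"
  proof (intro subset_antisym subsetI)
    fix n assume "n \<in> mu ` carrier F0"
    then show "n \<in> kernel F1_ext diffZ snd"
      by (auto simp: kernel_def mu_def smooth_deriv diffZ_id)
  next
    fix n assume "n \<in> kernel F1_ext diffZ snd"
    then obtain a where "n = (a, id)" "a \<in> smooth_fns" by (auto simp: kernel_def)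
    then show "n \<in> mu ` carrier F0"
      by (intro image_eqI[of _ _ "antideriv a"]) (auto simp: mu_def deriv_antideriv smooth_antideriv)
  qed
  show "snd ` carrier F1_ext = carrier diffZ"
    using smooth_const by (fastforce simp: image_iff)
  fix n v assume "n \<in> carrier F1_ext"
  show "F1_ext_act n (const_fn v) = const_fn v"
    by (cases n) (simp add: F1_ext_act_def const_fn_def pullback0_def)
qed

section \<open>The group cocycle\<close>

lemma topspace_diffZ_top [simp]: "topspace diffZ_top = carrier diffZ"
  using diffZD(1) by (auto simp: diffZ_top_def)

lemma continuous_map_diffZ_iff:
  "continuous_map T diffZ_top F \<longleftrightarrow>
     continuous_map T smooth_top F \<and> (\<forall>p\<in>topspace T. F p \<in> carrier diffZ)"
  by (auto simp: diffZ_top_def continuous_map_in_subtopology Pi_iff)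

lemma continuous_map_diffZ_smooth: "continuous_map T diffZ_top F \<Longrightarrow> continuous_map T smooth_top F"
  by (simp add: continuous_map_diffZ_iff)

lemma continuous_map_diffZ_comp:
  assumes "continuous_map T diffZ_top F" "continuous_map T diffZ_top G"
  shows "continuous_map T diffZ_top (\<lambda>p. F p \<circ> G p)"
  using assms smooth_family_comp[of T F G] unfolding continuous_map_diffZ_iff
  by (auto simp: o_def diffZ_comp[unfolded o_def])

lemma continuous_map_diffZ_inv:
  assumes "continuous_map T diffZ_top F"
  shows "continuous_map T diffZ_top (\<lambda>p. inv_into UNIV (F p))"
  using assms smooth_family_inv[of T F] unfolding continuous_map_diffZ_iff
  by (auto simp: diffZ_inv diffZD)

lemma continuous_map_log_deriv:
  assumes "continuous_map T diffZ_top F"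
  shows "continuous_map T smooth_top (\<lambda>p. log_deriv (F p))"
  unfolding log_deriv_def
  by (rule smooth_family_ln)
    (use assms in \<open>auto simp: continuous_map_diffZ_iff diffZD intro: continuous_map_smooth_deriv\<close>)

lemma continuous_map_B1:
  assumes "continuous_map T diffZ_top F" "continuous_map T diffZ_top G"
  shows "continuous_map T smooth_top (\<lambda>p. B1 (F p) (G p))"
  unfolding B1_def pullback0_def
  by (rule smooth_family_mult[OF smooth_family_comp[OF continuous_map_log_deriv[OF assms(1)]
        continuous_map_diffZ_smooth[OF assms(2)]]
      continuous_map_smooth_deriv[OF continuous_map_log_deriv[OF assms(2)]]])

section \<open>The primitive of \<open>B1\<close> and the resulting real cocycle\<close>

definition B1_primitive :: "fn \<Rightarrow> fn \<Rightarrow> fn" where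
  "B1_primitive \<Phi> \<Psi> = antideriv (B1 \<Phi> \<Psi>)"

definition gv_cochain :: "fn \<Rightarrow> fn \<Rightarrow> fn \<Rightarrow> real" where
  "gv_cochain \<Phi> \<Psi> \<Xi> = - B1_primitive \<Phi> \<Psi> (\<Xi> 0)"

lemma B1_primitive_0 [simp]: "B1_primitive \<Phi> \<Psi> 0 = 0"
  by (simp add: B1_primitive_def)

lemma B1_primitive_smooth: "\<Phi> \<in> carrier diffZ \<Longrightarrow> \<Psi> \<in> carrier diffZ \<Longrightarrow> B1_primitive \<Phi> \<Psi> \<in> smooth_fns"
  by (simp add: B1_primitive_def smooth_antideriv B1_smooth)

lemma deriv_B1_primitive: "\<Phi> \<in> carrier diffZ \<Longrightarrow> \<Psi> \<in> carrier diffZ \<Longrightarrow> deriv (B1_primitive \<Phi> \<Psi>) = B1 \<Phi> \<Psi>"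
  by (simp add: B1_primitive_def deriv_antideriv B1_smooth)

lemma continuous_map_B1_primitive:
  assumes "continuous_map T diffZ_top F" "continuous_map T diffZ_top G"
  shows "continuous_map T smooth_top (\<lambda>p. B1_primitive (F p) (G p))"
  unfolding B1_primitive_def by (intro smooth_family_antideriv continuous_map_B1 assms)

text \<open>The real number \<open>gv_cochain \<Phi> \<Psi> \<Xi>\<close> is the defect of the
  primitives from being a function-valued cocycle. By \<open>B1_cocycle\<close> the other terms on
  the two sides have equal derivatives; comparison with \<open>x = 0\<close>, where three primitives
  vanish, identifies the constant.\<close>

lemma B1_primitive_cocycle:
  assumes c: "\<Phi> \<in> carrier diffZ" "\<Psi> \<in> carrier diffZ" "\<Xi> \<in> carrier diffZ"
  shows "B1_primitive \<Phi> \<Psi> (\<Xi> x) + B1_primitive (\<Phi> \<circ> \<Psi>) \<Xi> x + gv_cochain \<Phi> \<Psi> \<Xi> = B1_primitive \<Psi> \<Xi> x + B1_primitive \<Phi> (\<Psi> \<circ> \<Xi>) x"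
proof -
  note sm = B1_primitive_smooth smooth_comp[OF B1_primitive_smooth diffZD(1)] diffZ_comp
  have "deriv (\<lambda>x. B1_primitive \<Phi> \<Psi> (\<Xi> x) + B1_primitive (\<Phi> \<circ> \<Psi>) \<Xi> x) = deriv (\<lambda>x. B1_primitive \<Psi> \<Xi> x + B1_primitive \<Phi> (\<Psi> \<circ> \<Xi>) x)"
    using B1_cocycle[OF c] c
    by (simp add: smooth_deriv_add sm smooth_deriv_comp diffZD deriv_B1_primitive pullback1_def)
  then have "B1_primitive \<Phi> \<Psi> (\<Xi> x) + B1_primitive (\<Phi> \<circ> \<Psi>) \<Xi> x - (B1_primitive \<Phi> \<Psi> (\<Xi> 0) + B1_primitive (\<Phi> \<circ> \<Psi>) \<Xi> 0)
    = B1_primitive \<Psi> \<Xi> x + B1_primitive \<Phi> (\<Psi> \<circ> \<Xi>) x - (B1_primitive \<Psi> \<Xi> 0 + B1_primitive \<Phi> (\<Psi> \<circ> \<Xi>) 0)"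
    by (intro smooth_diff_eqI smooth_add sm c)
  then show ?thesis by (simp add: gv_cochain_def)
qed

lemma continuous_map_gv_cochain:
  assumes "continuous_map T diffZ_top F" "continuous_map T diffZ_top G" "continuous_map T diffZ_top H"
  shows "continuous_map T euclideanreal (\<lambda>p. gv_cochain (F p) (G p) (H p))"
  unfolding gv_cochain_def
  by (intro continuous_map_minus continuous_map_eval[OF continuous_map_B1_primitive[OF assms(1,2)]]
      continuous_map_eval[OF continuous_map_diffZ_smooth[OF assms(3)]]) auto

lemma continuous_map_projections3:
  "continuous_map (prod_topology A (prod_topology B C)) A fst"
  "continuous_map (prod_topology A (prod_topology B C)) B (\<lambda>p. fst (snd p))"
  "continuous_map (prod_topology A (prod_topology B C)) C (\<lambda>p. snd (snd p))"
  using continuous_map_compose[OF continuous_map_snd continuous_map_fst]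
    continuous_map_compose[OF continuous_map_snd continuous_map_snd]
  by (auto simp: o_def continuous_map_fst)

lemma gv_cochain_Z3: "gv_cochain \<in> grp_Z3 diffZ diffZ_top"
  unfolding grp_Z3_def
proof (intro CollectI conjI ballI)
  show "cont_cochain3 diffZ_top gv_cochain"
    unfolding cont_cochain3_def case_prod_beta'
    by (intro continuous_map_gv_cochain continuous_map_projections3)
  fix x y z w assume c: "x \<in> carrier diffZ" "y \<in> carrier diffZ" "z \<in> carrier diffZ" "w \<in> carrier diffZ"
  show "cobd3 diffZ gv_cochain x y z w = 0"
    \<comment> \<open>The four terms of the coboundary that involve \<open>w\<close> are primitives
      taken at \<open>w 0\<close> or at \<open>z (w 0)\<close>, so the cocycle condition is the
      integrated identity at this one point.\<close>
    using B1_primitive_cocycle[OF c(1-3), of "w 0"] by (simp add: cobd3_def gv_cochain_def)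
qed

section \<open>Continuous choices and the class they determine\<close>

lemma cont_cochain2_comp:
  assumes "cont_cochain2 S b" "continuous_map T S F" "continuous_map T S G"
  shows "continuous_map T euclideanreal (\<lambda>p. b (F p) (G p))"
  using continuous_map_compose[OF continuous_map_pairedI[OF assms(2,3)] assms(1)[unfolded cont_cochain2_def]]
  by (simp add: o_def)

lemma add_cobd2_Z3:
  assumes c: "c \<in> grp_Z3 diffZ diffZ_top" and b: "cont_cochain2 diffZ_top b"
  shows "(\<lambda>x y z. c x y z + cobd2 diffZ b x y z) \<in> grp_Z3 diffZ diffZ_top"
  unfolding grp_Z3_def
proof (intro CollectI conjI ballI)
  have "continuous_map (prod_topology diffZ_top (prod_topology diffZ_top diffZ_top)) euclideanreal
     (\<lambda>p. c (fst p) (fst (snd p)) (snd (snd p)))"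
    using c by (simp add: grp_Z3_def cont_cochain3_def case_prod_beta')
  then show "cont_cochain3 diffZ_top (\<lambda>x y z. c x y z + cobd2 diffZ b x y z)"
    unfolding cont_cochain3_def cobd2_def case_prod_beta' diffZ_simps
    by (intro continuous_map_add continuous_map_diff cont_cochain2_comp[OF b] continuous_map_diffZ_comp
        continuous_map_projections3)
  fix x y z w assume "x \<in> carrier diffZ" "y \<in> carrier diffZ" "z \<in> carrier diffZ" "w \<in> carrier diffZ"
  then have "cobd3 diffZ c x y z w = 0"
    using c by (simp add: grp_Z3_def)
  then show "cobd3 diffZ (\<lambda>x y z. c x y z + cobd2 diffZ b x y z) x y z w = 0"
    by (simp add: cobd3_def cobd2_def comp_assoc)
qed

text \<open>The product of the two sections has first component \<open>B1 \<Phi> \<Psi>\<close>,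
  while multiplying \<open>mu ?b\<close> by the section over the composite pulls
  \<open>deriv ?b\<close> back along \<Phi> \<circ> \<Psi>. Hence \<open>?b\<close> composed with
  \<Phi> \<circ> \<Psi> has to be a primitive of \<open>B1\<close>, which explains the inverse in
  the formula.\<close>

lemma gv_choice:
  "cm_choice F0 smooth_top mu F1_ext F1_ext_top snd diffZ diffZ_top
     (\<lambda>\<Phi>. (\<lambda>x. 0, \<Phi>)) (\<lambda>\<Phi> \<Psi> x. B1_primitive \<Phi> \<Psi> (inv_into UNIV (\<Phi> \<circ> \<Psi>) x))"
  unfolding cm_choice_def
proof (intro conjI ballI)
  show "continuous_map diffZ_top F1_ext_top (\<lambda>\<Phi>. (\<lambda>x. 0, \<Phi>))"
    unfolding F1_ext_top_def
    by (intro continuous_map_pairedI) (auto simp: smooth_const)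
  show "continuous_map (prod_topology diffZ_top diffZ_top) smooth_top
     (\<lambda>(\<Phi>, \<Psi>). \<lambda>x. B1_primitive \<Phi> \<Psi> (inv_into UNIV (\<Phi> \<circ> \<Psi>) x))"
    unfolding case_prod_beta'
    by (rule smooth_family_comp[OF continuous_map_B1_primitive
          continuous_map_diffZ_smooth[OF continuous_map_diffZ_inv[OF continuous_map_diffZ_comp]]])
      (rule continuous_map_fst continuous_map_snd)+
  fix \<Phi> \<Psi> assume c: "\<Phi> \<in> carrier diffZ" "\<Psi> \<in> carrier diffZ"
  let ?b = "\<lambda>x. B1_primitive \<Phi> \<Psi> (inv_into UNIV (\<Phi> \<circ> \<Psi>) x)"
  note c2 = diffZ_comp[OF c]
  have "?b \<in> smooth_fns"
    by (intro smooth_comp[OF B1_primitive_smooth] diffZD(1) diffZ_inv c c2)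
  then have "pullback1 (\<Phi> \<circ> \<Psi>) (deriv ?b) = deriv (\<lambda>x. ?b ((\<Phi> \<circ> \<Psi>) x))"
    by (rule pullback1_deriv[OF c2])
  also have "\<dots> = B1 \<Phi> \<Psi>"
    unfolding diffZ_inv_simps(2)[OF c2] by (rule deriv_B1_primitive[OF c])
  finally have "pullback1 (\<Phi> \<circ> \<Psi>) (deriv ?b) = B1 \<Phi> \<Psi>" .
  then show "(\<lambda>x. 0, \<Phi>) \<otimes>\<^bsub>F1_ext\<^esub> (\<lambda>x. 0, \<Psi>) = mu ?b \<otimes>\<^bsub>F1_ext\<^esub> (\<lambda>x. 0, \<Phi> \<otimes>\<^bsub>diffZ\<^esub> \<Psi>)"
    unfolding mu_def F1_ext_simps diffZ_simps by (simp add: pullback1_def)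
qed simp

text \<open>The relation between \<rho> and \<beta> is integrated along the composite
  diffeomorphism. It determines \<beta> from primitives of the 1-form parts of \<rho>, from
  \<open>B1_primitive\<close>, and from one integration constant per pair; these constants form the
  2-cochain \<open>b\<close>.\<close>

lemma gv_class_of_choice:
  assumes ch: "cm_choice F0 smooth_top mu F1_ext F1_ext_top snd diffZ diffZ_top \<rho> \<beta>"
  obtains b where "cont_cochain2 diffZ_top b"
    "\<And>x y z. x \<in> carrier diffZ \<Longrightarrow> y \<in> carrier diffZ \<Longrightarrow> z \<in> carrier diffZ \<Longrightarrow>
       const_fn (gv_cochain x y z + cobd2 diffZ b x y z) = cm_gamma F0 diffZ F1_ext_act \<rho> \<beta> x y z"
proof -
  define r where "r x = fst (\<rho> x)" for x
  define R where "R x = antideriv (r x)" for x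
  \<comment> \<open>The integration constant: what is left of \<beta> at parameter
    \<open>t = 0\<close>, where \<open>R y\<close>, \<open>R (x \<circ> y)\<close> and
    \<open>B1_primitive x y\<close> vanish.\<close>
  define b where "b x y = \<beta> x y (x (y 0)) - R x (y 0)" for x y
  have \<rho>c: "continuous_map diffZ_top (prod_topology smooth_top diffZ_top) \<rho>"
    using ch by (simp add: cm_choice_def F1_ext_top_def)
  have \<beta>c: "continuous_map (prod_topology diffZ_top diffZ_top) smooth_top (\<lambda>p. \<beta> (fst p) (snd p))"
    using ch by (simp add: cm_choice_def case_prod_beta')
  have rc: "continuous_map diffZ_top smooth_top r"
    using continuous_map_compose[OF \<rho>c continuous_map_fst] by (simp add: o_def r_def[abs_def])
  have Rc: "continuous_map diffZ_top smooth_top R"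
    unfolding R_def by (rule smooth_family_antideriv[OF rc])
  have \<rho>: "\<rho> x = (r x, x)" if "x \<in> carrier diffZ" for x
    using ch that by (simp add: cm_choice_def r_def prod_eq_iff)
  have rs: "r x \<in> smooth_fns" "R x \<in> smooth_fns" if "x \<in> carrier diffZ" for x
    using continuous_map_image_subset_topspace[OF rc] continuous_map_image_subset_topspace[OF Rc] that by auto
  have \<beta>s: "\<beta> x y \<in> smooth_fns" if "x \<in> carrier diffZ" "y \<in> carrier diffZ" for x y
    using continuous_map_image_subset_topspace[OF \<beta>c] that by (auto simp: image_subset_iff)
  have bc: "cont_cochain2 diffZ_top b"
  proof -
    let ?T = "prod_topology diffZ_top diffZ_top"
    have y0: "continuous_map ?T euclideanreal (\<lambda>p. snd p 0)"
      by (rule continuous_map_eval[OF continuous_map_diffZ_smooth[OF continuous_map_snd]]) simp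
    have "continuous_map ?T euclideanreal (\<lambda>p. fst p (snd p 0))"
      by (rule continuous_map_eval[OF continuous_map_diffZ_smooth[OF continuous_map_fst] y0])
    then have "continuous_map ?T euclideanreal (\<lambda>p. \<beta> (fst p) (snd p) (fst p (snd p 0)))"
      by (rule continuous_map_eval[OF \<beta>c])
    moreover have "continuous_map ?T euclideanreal (\<lambda>p. R (fst p) (snd p 0))"
      using continuous_map_eval[OF continuous_map_compose[OF continuous_map_fst Rc] y0] by (simp add: o_def)
    ultimately show ?thesis
      unfolding cont_cochain2_def case_prod_beta' b_def by (rule continuous_map_diff)
  qed
  have \<beta>: "\<beta> x y (x (y t)) = b x y + R x (y t) + R y t - R (x \<circ> y) t + B1_primitive x y t"
    if c: "x \<in> carrier diffZ" "y \<in> carrier diffZ" for x y t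
  proof -
    note c2 = diffZ_comp[OF c]
    have "\<rho> x \<otimes>\<^bsub>F1_ext\<^esub> \<rho> y = mu (\<beta> x y) \<otimes>\<^bsub>F1_ext\<^esub> \<rho> (x \<circ> y)"
      using ch c by (simp add: cm_choice_def)
    then have eq: "pullback1 y (r x) t + r y t + B1 x y t = pullback1 (x \<circ> y) (deriv (\<beta> x y)) t + r (x \<circ> y) t" for t
      by (simp add: \<rho> c c2 mu_def fun_eq_iff)
    have dR: "deriv (R x) = r x" if "x \<in> carrier diffZ" for x
      unfolding R_def by (rule deriv_antideriv[OF rs(1)[OF that]])
    have sm: "(\<lambda>t. R x (y t)) \<in> smooth_fns" "(\<lambda>t. \<beta> x y ((x \<circ> y) t)) \<in> smooth_fns"
      by (intro smooth_comp[OF rs(2)] smooth_comp[OF \<beta>s] diffZD(1) c c2)+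
    have p: "pullback1 (x \<circ> y) (deriv (\<beta> x y)) = deriv (\<lambda>t. \<beta> x y ((x \<circ> y) t))"
      "pullback1 y (r x) = deriv (\<lambda>t. R x (y t))"
      using pullback1_deriv[OF c2 \<beta>s[OF c]] pullback1_deriv[OF c(2) rs(2)[OF c(1)]] by (simp_all add: dR c)
    have "deriv (\<lambda>t. \<beta> x y ((x \<circ> y) t) + R (x \<circ> y) t)
      = (\<lambda>t. pullback1 (x \<circ> y) (deriv (\<beta> x y)) t + r (x \<circ> y) t)"
      unfolding smooth_deriv_add[OF sm(2) rs(2)[OF c2]] p dR[OF c2] ..
    also have "\<dots> = (\<lambda>t. pullback1 y (r x) t + r y t + B1 x y t)"
      by (simp only: eq)
    also have "\<dots> = deriv (\<lambda>t. R x (y t) + R y t + B1_primitive x y t)"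
      by (simp add: p smooth_deriv_add smooth_add sm rs c B1_primitive_smooth deriv_B1_primitive dR)
    finally have "deriv (\<lambda>t. \<beta> x y ((x \<circ> y) t) + R (x \<circ> y) t) = deriv (\<lambda>t. R x (y t) + R y t + B1_primitive x y t)" .
    then have "(\<beta> x y ((x \<circ> y) t) + R (x \<circ> y) t) - (\<beta> x y ((x \<circ> y) 0) + R (x \<circ> y) 0)
      = (R x (y t) + R y t + B1_primitive x y t) - (R x (y 0) + R y 0 + B1_primitive x y 0)"
      by (intro smooth_diff_eqI smooth_add sm rs B1_primitive_smooth c c2)
    then show ?thesis by (simp add: b_def R_def)
  qed
  show thesis
  proof (rule that[OF bc])
    fix x y z assume c: "x \<in> carrier diffZ" "y \<in> carrier diffZ" "z \<in> carrier diffZ"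
    note c2 = diffZ_comp[OF c(1,2)] diffZ_comp[OF c(2,3)]
    show "const_fn (gv_cochain x y z + cobd2 diffZ b x y z) = cm_gamma F0 diffZ F1_ext_act \<rho> \<beta> x y z"
    proof
      fix q
      \<comment> \<open>Written in terms of \<open>t\<close>, each of the four values of \<beta> is
        taken at an image point of the composite of its two arguments, the form in which \<beta> was
        computed.\<close>
      define t where "t = inv_into UNIV (x \<circ> (y \<circ> z)) q"
      have q: "q = x (y (z t))"
        using diffZ_inv_simps(1)[OF diffZ_comp[OF c(1) c2(2)], of q] by (simp add: t_def)
      have "cm_gamma F0 diffZ F1_ext_act \<rho> \<beta> x y z q
        = \<beta> y z (y (z t)) + \<beta> x (y \<circ> z) (x ((y \<circ> z) t)) - \<beta> (x \<circ> y) z ((x \<circ> y) (z t)) - \<beta> x y (x (y (z t)))"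
        by (simp add: cm_gamma_def F0_inv \<beta>s c c2 \<rho> F1_ext_act_def pullback0_def q diffZ_inv_simps)
      \<comment> \<open>All terms in \<open>R\<close> cancel, since they form the coboundary of a
        coboundary.\<close>
      also have "\<dots> = b y z + b x (y \<circ> z) - b (x \<circ> y) z - b x y
          + (B1_primitive y z t + B1_primitive x (y \<circ> z) t - B1_primitive (x \<circ> y) z t - B1_primitive x y (z t))"
        using \<beta>[OF c(2,3), of t] \<beta>[OF c(1) c2(2), of t] \<beta>[OF c2(1) c(3), of t] \<beta>[OF c(1,2), of "z t"]
        by (simp add: comp_assoc)
      also have "\<dots> = gv_cochain x y z + cobd2 diffZ b x y z"
        using B1_primitive_cocycle[OF c, of t] by (simp add: cobd2_def)
      finally show "const_fn (gv_cochain x y z + cobd2 diffZ b x y z) q = cm_gamma F0 diffZ F1_ext_act \<rho> \<beta> x y z q"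
        by (simp add: const_fn_def)
    qed
  qed
qed

lemma gv_cochain_represents:
  "cm_represents const_fn F0 smooth_top mu F1_ext F1_ext_top snd diffZ diffZ_top F1_ext_act
     (grp_coh3 diffZ diffZ_top `` {gv_cochain})"
  unfolding cm_represents_def
proof (intro conjI allI impI)
  show "grp_coh3 diffZ diffZ_top `` {gv_cochain} \<in> grp_H3 diffZ diffZ_top"
    unfolding grp_H3_def by (rule quotientI[OF gv_cochain_Z3])
  show "\<exists>\<rho> \<beta>. cm_choice F0 smooth_top mu F1_ext F1_ext_top snd diffZ diffZ_top \<rho> \<beta>"
    using gv_choice by blast
  fix \<rho> \<beta> assume "cm_choice F0 smooth_top mu F1_ext F1_ext_top snd diffZ diffZ_top \<rho> \<beta>"
  then obtain b where b: "cont_cochain2 diffZ_top b"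
    "\<And>x y z. x \<in> carrier diffZ \<Longrightarrow> y \<in> carrier diffZ \<Longrightarrow> z \<in> carrier diffZ \<Longrightarrow>
       const_fn (gv_cochain x y z + cobd2 diffZ b x y z) = cm_gamma F0 diffZ F1_ext_act \<rho> \<beta> x y z"
    using gv_class_of_choice by blast
  let ?c = "\<lambda>x y z. gv_cochain x y z + cobd2 diffZ b x y z"
  have "?c \<in> grp_coh3 diffZ diffZ_top `` {gv_cochain}"
    using gv_cochain_Z3 add_cobd2_Z3[OF gv_cochain_Z3 b(1)] b(1) by (auto simp: grp_coh3_def)
  then show "\<exists>c\<in>grp_coh3 diffZ diffZ_top `` {gv_cochain}. \<forall>x\<in>carrier diffZ. \<forall>y\<in>carrier diffZ. \<forall>z\<in>carrier diffZ.
      const_fn (c x y z) = cm_gamma F0 diffZ F1_ext_act \<rho> \<beta> x y z"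
    using b(2) by (intro bexI[of _ ?c]) auto
qed

section \<open>The infinitesimal cocycle\<close>

lemma topspace_vect_top [simp]: "topspace vect_top = vect"
  by (auto simp: vect_top_def vect_def)

lemma vectD:
  assumes "f \<in> vect"
  shows "f \<in> smooth_fns" "f (x + 1) = f x"
  using assms by (auto simp: vect_def)

lemma periodic_deriv:
  assumes a: "a \<in> smooth_fns" and per: "\<And>x. a (x + 1) = a x + c"
  shows "deriv a (x + 1) = deriv a x"
proof -
  have s: "(\<lambda>x. x + 1) \<in> smooth_fns" by (intro smooth_add smooth_ident smooth_const)
  have "deriv (\<lambda>x. a (x + 1)) = (\<lambda>x. deriv a (x + 1))"
    using smooth_deriv_comp[OF a s] by simp
  moreover have "deriv (\<lambda>x. a x + c) = deriv a"
    using smooth_deriv_add[OF a smooth_const] by simp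
  ultimately show ?thesis using per by (metis (no_types, lifting) ext)
qed

lemma vect_lincomb: "f \<in> vect \<Longrightarrow> g \<in> vect \<Longrightarrow> (\<lambda>x. r * f x + s * g x) \<in> vect"
  by (auto simp: vect_def intro!: smooth_add smooth_scale)

lemma vect_bracket: "f \<in> vect \<Longrightarrow> g \<in> vect \<Longrightarrow> vbracket f g \<in> vect"
  using periodic_deriv[of f 0] periodic_deriv[of g 0]
    smooth_add[OF smooth_mult[of f "deriv g"] smooth_minus[OF smooth_mult[of "deriv f" g]]]
  by (simp add: vect_def vbracket_def smooth_deriv)

text \<open>The products of first derivatives cancel in the first equation. The second
  differentiates the right-hand side of the first, so rewriting with both gives the second
  derivative of a bracket.\<close>

lemma vbracket_deriv:
  assumes "f \<in> smooth_fns" "g \<in> smooth_fns"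
  shows "deriv (vbracket f g) = (\<lambda>x. f x * deriv (deriv g) x - deriv (deriv f) x * g x)"
    "deriv (\<lambda>x. f x * deriv (deriv g) x - deriv (deriv f) x * g x) = (\<lambda>x. deriv f x * deriv (deriv g) x + f x * deriv (deriv (deriv g)) x
       - deriv (deriv (deriv f)) x * g x - deriv (deriv f) x * deriv g x)"
proof -
  have diff: "deriv (\<lambda>x. a x - b x) = (\<lambda>x. deriv a x - deriv b x)" if "a \<in> smooth_fns" "b \<in> smooth_fns" for a b
    by (intro ext DERIV_imp_deriv DERIV_diff smooth_has_deriv that)
  note d = diff smooth_deriv_mult smooth_mult smooth_deriv assms
  show "deriv (vbracket f g) = (\<lambda>x. f x * deriv (deriv g) x - deriv (deriv f) x * g x)"
    unfolding vbracket_def by (simp add: d algebra_simps)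
  show "deriv (\<lambda>x. f x * deriv (deriv g) x - deriv (deriv f) x * g x) = (\<lambda>x. deriv f x * deriv (deriv g) x + f x * deriv (deriv (deriv g)) x
       - deriv (deriv (deriv f)) x * g x - deriv (deriv f) x * deriv g x)"
    by (simp add: d algebra_simps)
qed

lemma theta0_eq:
  "theta0 f g h = f 0 * deriv g 0 * deriv (deriv h) 0 + g 0 * deriv h 0 * deriv (deriv f) 0
    + h 0 * deriv f 0 * deriv (deriv g) 0 - f 0 * deriv h 0 * deriv (deriv g) 0
    - g 0 * deriv f 0 * deriv (deriv h) 0 - h 0 * deriv g 0 * deriv (deriv f) 0"
  by (simp add: theta0_def det_3 vector_3)

lemma continuous_map_vect_eval:
  assumes "continuous_map T vect_top F"
  shows "continuous_map T euclideanreal (\<lambda>p. (deriv ^^ k) (F p) 0)"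
  using assms by (intro continuous_map_eval_deriv) (auto simp: vect_top_def continuous_map_in_subtopology)

lemma theta0_alt3: "alt3 theta0"
  unfolding alt3_def
proof (intro conjI ballI allI)
  have ev: "continuous_map T euclideanreal (\<lambda>p. F p 0)" "continuous_map T euclideanreal (\<lambda>p. deriv (F p) 0)"
    "continuous_map T euclideanreal (\<lambda>p. deriv (deriv (F p)) 0)"
    if "continuous_map T vect_top F" for T :: "(fn \<times> fn \<times> fn) topology" and F
    using continuous_map_vect_eval[OF that, of 0] continuous_map_vect_eval[OF that, of 1]
      continuous_map_vect_eval[OF that, of 2] by (simp_all add: numeral_2_eq_2)
  note e = ev[OF continuous_map_projections3(1)] ev[OF continuous_map_projections3(2)]
    ev[OF continuous_map_projections3(3)]
  show "continuous_map (prod_topology vect_top (prod_topology vect_top vect_top)) euclideanreal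
      (\<lambda>(f, g, h). theta0 f g h)"
    unfolding case_prod_beta' theta0_eq
    by (intro continuous_map_add continuous_map_diff continuous_map_real_mult e)
  fix f g h k and r s :: real assume v: "f \<in> vect" "g \<in> vect" "h \<in> vect" "k \<in> vect"
  note sm = vectD(1)[OF v(1)] vectD(1)[OF v(2)]
  have "deriv (\<lambda>x. r * f x + s * g x) = (\<lambda>x. r * deriv f x + s * deriv g x)"
    by (simp add: smooth_deriv_add smooth_deriv_scale smooth_scale sm)
  moreover have "deriv (\<lambda>x. r * deriv f x + s * deriv g x) = (\<lambda>x. r * deriv (deriv f) x + s * deriv (deriv g) x)"
    by (simp add: smooth_deriv_add smooth_deriv_scale smooth_scale sm smooth_deriv)
  ultimately show "theta0 (\<lambda>x. r * f x + s * g x) h k = r * theta0 f h k + s * theta0 g h k"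
    by (simp add: theta0_eq algebra_simps)
next
  fix f g h
  show "theta0 g f h = - theta0 f g h" "theta0 f h g = - theta0 f g h"
    by (simp_all add: theta0_eq)
qed

text \<open>A polynomial identity in the 3-jets of the four fields at 0: brackets bring in third
  derivatives, and these cancel in the alternating sum.\<close>

lemma theta0_Z3: "theta0 \<in> lie_Z3"
  unfolding lie_Z3_def
proof (intro CollectI conjI ballI theta0_alt3)
  fix f g h k assume "f \<in> vect" "g \<in> vect" "h \<in> vect" "k \<in> vect"
  then show "lie_d3 theta0 f g h k = 0"
    unfolding lie_d3_def theta0_eq
    by (simp add: vbracket_deriv vectD) (simp add: vbracket_def algebra_simps)
qed

lemma alt3_cong:
  assumes "alt3 \<omega>" "\<And>f g h. f \<in> vect \<Longrightarrow> g \<in> vect \<Longrightarrow> h \<in> vect \<Longrightarrow> \<omega>' f g h = \<omega> f g h"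
  shows "alt3 \<omega>'"
  unfolding alt3_def
proof (intro conjI ballI allI)
  have "continuous_map (prod_topology vect_top (prod_topology vect_top vect_top)) euclideanreal
      (\<lambda>(f, g, h). \<omega> f g h)"
    using assms(1) unfolding alt3_def by blast
  then show "continuous_map (prod_topology vect_top (prod_topology vect_top vect_top)) euclideanreal
      (\<lambda>(f, g, h). \<omega>' f g h)"
    by (rule continuous_map_eq) (auto simp: assms(2))
next
  fix f g h k and r s :: real assume v: "f \<in> vect" "g \<in> vect" "h \<in> vect" "k \<in> vect"
  then have "\<omega> (\<lambda>x. r * f x + s * g x) h k = r * \<omega> f h k + s * \<omega> g h k"
    using assms(1) unfolding alt3_def by blast
  then show "\<omega>' (\<lambda>x. r * f x + s * g x) h k = r * \<omega>' f h k + s * \<omega>' g h k"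
    using assms(2) v vect_lincomb by metis
next
  fix f g h assume v: "f \<in> vect" "g \<in> vect" "h \<in> vect"
  then have "\<omega> g f h = - \<omega> f g h" "\<omega> f h g = - \<omega> f g h"
    using assms(1) unfolding alt3_def by blast+
  then show "\<omega>' g f h = - \<omega>' f g h" "\<omega>' f h g = - \<omega>' f g h"
    using v by (simp_all add: assms(2))
qed

lemma lie_Z3_cong:
  assumes "\<omega> \<in> lie_Z3" "\<And>f g h. f \<in> vect \<Longrightarrow> g \<in> vect \<Longrightarrow> h \<in> vect \<Longrightarrow> \<omega>' f g h = \<omega> f g h"
  shows "\<omega>' \<in> lie_Z3"
  using assms alt3_cong[of \<omega> \<omega>'] by (auto simp: lie_Z3_def lie_d3_def vect_bracket)

text \<open>Cochains are total functions, whereas the derivative of the group cocycle is computed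
  for arguments in \<open>vect\<close> only. Agreement there suffices, with the zero 2-cochain as
  witness.\<close>

lemma lie_class_cong:
  assumes "\<omega> \<in> lie_Z3" "\<And>f g h. f \<in> vect \<Longrightarrow> g \<in> vect \<Longrightarrow> h \<in> vect \<Longrightarrow> \<omega>' f g h = \<omega> f g h"
  shows "\<omega>' \<in> lie_class \<omega>"
proof -
  have "alt2 (\<lambda>f g. 0)" by (auto simp: alt2_def case_prod_beta')
  then show ?thesis
    using assms lie_Z3_cong[OF assms]
    by (auto simp: lie_class_def lie_coh3_def lie_d2_def intro!: exI[of _ "\<lambda>f g. 0"])
qed

section \<open>Lines in the group and the derivative of the cocycle at the identity\<close>

lemma periodic_frac:
  fixes a :: "real \<Rightarrow> real"
  assumes "\<And>x. a (x + 1) = a x"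
  shows "a (frac x) = a x"
  using quasi_periodic_int[of a 0 x "- \<lfloor>x\<rfloor>"] assms by (simp add: frac_def)

text \<open>The diffeomorphisms are open in the affine space \<open>id + vect\<close>: a smooth periodic positive function has
  a positive minimum.\<close>

lemma diffZ_line:
  assumes P: "\<Phi> \<in> carrier diffZ" and f: "f \<in> vect"
  obtains d where "d > 0" "\<And>t. \<bar>t\<bar> < d \<Longrightarrow> (\<lambda>x. \<Phi> x + t * f x) \<in> carrier diffZ"
proof -
  note sm = diffZD(1)[OF P] vectD(1)[OF f]
  have per: "deriv \<Phi> (frac x) = deriv \<Phi> x" "deriv f (frac x) = deriv f x" for x
    using periodic_deriv[of \<Phi> 1] periodic_deriv[of f 0] diffZD(4)[OF P] vectD(2)[OF f] sm
    by (intro periodic_frac; simp)+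
  obtain m where m: "m \<in> {0..1}" "\<And>x. x \<in> {0..1} \<Longrightarrow> deriv \<Phi> m \<le> deriv \<Phi> x"
    using continuous_attains_inf[of "{0..1}" "deriv \<Phi>"] smooth_continuous[OF smooth_deriv[OF sm(1)]] by auto
  have "continuous_on {0..1} (\<lambda>x. \<bar>deriv f x\<bar>)"
    by (intro continuous_intros smooth_continuous smooth_deriv sm)
  then obtain n where n: "n \<in> {0..1}" "\<And>x. x \<in> {0..1} \<Longrightarrow> \<bar>deriv f x\<bar> \<le> \<bar>deriv f n\<bar>"
    using continuous_attains_sup[of "{0..1}" "\<lambda>x. \<bar>deriv f x\<bar>"] by auto
  \<comment> \<open>Adding 1 keeps \<open>M\<close> positive even for constant \<open>f\<close> and
    makes the bound on \<open>deriv f\<close> strict.\<close>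
  define M where "M = \<bar>deriv f n\<bar> + 1"
  have M: "M > 0" "\<bar>deriv f x\<bar> < M" for x
  proof -
    have "\<bar>deriv f (frac x)\<bar> \<le> \<bar>deriv f n\<bar>"
      by (intro n(2)) (auto simp: frac_ge_0 less_imp_le[OF frac_lt_1])
    then show "\<bar>deriv f x\<bar> < M" by (simp add: M_def per)
  qed (simp add: M_def)
  have low: "deriv \<Phi> m \<le> deriv \<Phi> x" for x
    using m(2)[of "frac x"] by (simp add: per frac_ge_0 less_imp_le[OF frac_lt_1])
  have pos: "deriv \<Phi> m > 0" by (rule diffZD(2)[OF P])
  show thesis
  proof (rule that[of "deriv \<Phi> m / M"])
    show "0 < deriv \<Phi> m / M" using pos M by simp
    fix t assume t: "\<bar>t\<bar> < deriv \<Phi> m / M"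
    show "(\<lambda>x. \<Phi> x + t * f x) \<in> carrier diffZ"
    proof (rule diffZI)
      show "(\<lambda>x. \<Phi> x + t * f x) \<in> smooth_fns" by (intro smooth_add smooth_scale sm)
      fix x
      show "\<Phi> (x + 1) + t * f (x + 1) = \<Phi> x + t * f x + 1"
        using diffZD(4)[OF P, of x] vectD(2)[OF f, of x] by simp
      have "\<bar>t * deriv f x\<bar> \<le> \<bar>t\<bar> * M"
        using M(2)[of x] by (simp add: abs_mult mult_left_mono)
      also have "\<dots> < deriv \<Phi> m" using t M(1) by (simp add: pos_less_divide_eq)
      finally show "deriv (\<lambda>x. \<Phi> x + t * f x) x > 0"
        using low[of x] by (simp add: smooth_deriv_add smooth_deriv_scale smooth_scale sm)
    qed
  qed
qed

lemma eventually_diffZ_id_minus: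
  assumes "f \<in> vect"
  shows "\<forall>\<^sub>F s in nhds 0. (\<lambda>x. x - s * f x) \<in> carrier diffZ"
proof -
  obtain d where d: "d > 0" "\<And>t. \<bar>t\<bar> < d \<Longrightarrow> (\<lambda>x. id x + t * f x) \<in> carrier diffZ"
    using diffZ_line[OF diffZ_id assms] by blast
  have "\<forall>\<^sub>F s in nhds 0. dist s 0 < d"
    using d(1) by (rule eventually_nhds_ball[unfolded mem_ball, simplified dist_commute])
  then show ?thesis
    by eventually_elim (use d(2)[of "- s" for s] in simp)
qed

text \<open>The derivatives are computed from the innermost outwards. Each of the three curves
  contributes a minus sign through its direction, and the sign in \<open>gv_cochain\<close> makes
  the total positive.\<close>

lemma mixed_deriv_gv_cochain:
  assumes v: "f \<in> vect" "g \<in> vect" "h \<in> vect"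
  shows "mixed_deriv gv_cochain f g h = deriv f 0 * deriv (deriv g) 0 * h 0"
proof -
  define A where "A s = (\<lambda>x. x - s * f x)" for s
  define B where "B t = (\<lambda>x. x - t * g x)" for t
  note sm = vectD(1)[OF v(1)] vectD(1)[OF v(2)] vectD(1)[OF v(3)]
  \<comment> \<open>The closed formulas hold only while the curves stay in the group, so they are
    known near 0 and enter the outer derivatives through \<open>deriv_cong_ev\<close>.\<close>
  have evA: "\<forall>\<^sub>F s in nhds 0. A s \<in> carrier diffZ" and evB: "\<forall>\<^sub>F s in nhds 0. B s \<in> carrier diffZ"
    unfolding A_def B_def by (intro eventually_diffZ_id_minus v)+
  have dline: "deriv (\<lambda>x. x - t * a x) = (\<lambda>x. 1 - t * deriv a x)" if "a \<in> smooth_fns" for a t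
    using smooth_has_deriv[OF that] by (intro ext DERIV_imp_deriv) (auto intro!: derivative_eq_intros)
  \<comment> \<open>The third argument enters only through its value at 0, so its curve is not
    restricted to small \<open>u\<close>.\<close>
  have 1: "deriv (\<lambda>u. gv_cochain \<Phi> \<Psi> (\<lambda>x. x - u * h x)) 0 = B1 \<Phi> \<Psi> 0 * h 0"
    if "\<Phi> \<in> carrier diffZ" "\<Psi> \<in> carrier diffZ" for \<Phi> \<Psi>
  proof (rule DERIV_imp_deriv)
    have "(B1_primitive \<Phi> \<Psi> has_real_derivative B1 \<Phi> \<Psi> 0) (at (0 - 0 * h 0))"
      using smooth_has_deriv[OF B1_primitive_smooth[OF that], of 0] by (simp add: deriv_B1_primitive that)
    moreover have "((\<lambda>u. 0 - u * h 0) has_real_derivative - h 0) (at 0)"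
      by (auto intro!: derivative_eq_intros)
    ultimately have "((\<lambda>u. B1_primitive \<Phi> \<Psi> (0 - u * h 0)) has_real_derivative B1 \<Phi> \<Psi> 0 * (- h 0)) (at 0)"
      by (rule DERIV_chain2)
    then show "((\<lambda>u. gv_cochain \<Phi> \<Psi> (\<lambda>x. x - u * h x)) has_real_derivative B1 \<Phi> \<Psi> 0 * h 0) (at 0)"
      unfolding gv_cochain_def using DERIV_minus by fastforce
  qed
  have 2: "deriv (\<lambda>t. deriv (\<lambda>u. gv_cochain \<Phi> (B t) (\<lambda>x. x - u * h x)) 0) 0
      = - (log_deriv \<Phi> 0 * deriv (deriv g) 0 * h 0)"
    if \<Phi>: "\<Phi> \<in> carrier diffZ" for \<Phi>
  proof -
    let ?F = "\<lambda>t. log_deriv \<Phi> (- t * g 0) * (- t * deriv (deriv g) 0 / (1 - t * deriv g 0)) * h 0"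
    have "\<forall>\<^sub>F t in nhds 0. deriv (\<lambda>u. gv_cochain \<Phi> (B t) (\<lambda>x. x - u * h x)) 0 = ?F t"
      using evB
    proof eventually_elim
      case (elim t)
      have B': "deriv (B t) = (\<lambda>x. 1 - t * deriv g x)" unfolding B_def by (rule dline[OF sm(2)])
      have pos: "1 - t * deriv g x > 0" for x using diffZD(2)[OF elim, of x] by (simp add: B')
      have "deriv (log_deriv (B t)) 0 = - t * deriv (deriv g) 0 / (1 - t * deriv g 0)"
        unfolding log_deriv_def B'
        by (rule DERIV_imp_deriv) (use pos[of 0] smooth_has_deriv[OF smooth_deriv[OF sm(2)]] in
          \<open>auto intro!: derivative_eq_intros\<close>)
      then show ?case
        by (simp add: 1[OF \<Phi> elim] B1_def pullback0_def) (simp add: B_def)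
    qed
    then have "deriv (\<lambda>t. deriv (\<lambda>u. gv_cochain \<Phi> (B t) (\<lambda>x. x - u * h x)) 0) 0 = deriv ?F 0"
      by (rule deriv_cong_ev) simp
    also have "(?F has_real_derivative - (log_deriv \<Phi> 0 * deriv (deriv g) 0 * h 0)) (at 0)"
    proof -
      have "(log_deriv \<Phi> has_real_derivative deriv (log_deriv \<Phi>) 0) (at (- 0 * g 0))"
        using smooth_has_deriv[OF log_deriv_smooth[OF \<Phi>]] by simp
      moreover have "((\<lambda>t. - t * g 0) has_real_derivative - g 0) (at 0)"
        by (auto intro!: derivative_eq_intros)
      \<comment> \<open>Only differentiability of this factor affects the result: in the product
        rule its derivative is multiplied by a factor that vanishes at \<open>t = 0\<close>.\<close>
      ultimately have L: "((\<lambda>t. log_deriv \<Phi> (- t * g 0)) has_real_derivative deriv (log_deriv \<Phi>) 0 * (- g 0)) (at 0)"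
        by (rule DERIV_chain2)
      show ?thesis
        by (rule derivative_eq_intros L refl | simp)+
    qed
    then have "deriv ?F 0 = - (log_deriv \<Phi> 0 * deriv (deriv g) 0 * h 0)" by (rule DERIV_imp_deriv)
    finally show ?thesis .
  qed
  have "\<forall>\<^sub>F s in nhds 0. deriv (\<lambda>t. deriv (\<lambda>u. gv_cochain (A s) (B t) (\<lambda>x. x - u * h x)) 0) 0
      = - (ln (1 - s * deriv f 0) * deriv (deriv g) 0 * h 0)"
    using evA
  proof eventually_elim
    case (elim s)
    have "deriv (A s) = (\<lambda>x. 1 - s * deriv f x)" unfolding A_def by (rule dline[OF sm(1)])
    then show ?case by (simp add: 2[OF elim] log_deriv_def)
  qed
  then have "mixed_deriv gv_cochain f g h = deriv (\<lambda>s. - (ln (1 - s * deriv f 0) * deriv (deriv g) 0 * h 0)) 0"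
    unfolding mixed_deriv_def A_def B_def by (rule deriv_cong_ev) simp
  also have "\<dots> = deriv f 0 * deriv (deriv g) 0 * h 0"
    by (rule DERIV_imp_deriv) (auto intro!: derivative_eq_intros)
  finally show ?thesis .
qed

lemma van_est_map_gv_cochain:
  "f \<in> vect \<Longrightarrow> g \<in> vect \<Longrightarrow> h \<in> vect \<Longrightarrow> van_est_map gv_cochain f g h = theta0 f g h"
  by (simp add: van_est_map_def mixed_deriv_gv_cochain theta0_eq algebra_simps)

section \<open>Smoothness of the cocycle\<close>

abbreviation "diffZ3 \<equiv> carrier diffZ \<times> carrier diffZ \<times> carrier diffZ"
abbreviation "vect3 \<equiv> vect \<times> vect \<times> vect"
abbreviation "diffZ3_top \<equiv> prod_topology diffZ_top (prod_topology diffZ_top diffZ_top)"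
abbreviation "vect3_top \<equiv> prod_topology vect_top (prod_topology vect_top vect_top)"

lemma line3_simps:
  "line3 P w t = (\<lambda>x. fst P x + t * fst w x, \<lambda>x. fst (snd P) x + t * fst (snd w) x,
     \<lambda>x. snd (snd P) x + t * snd (snd w) x)"
  by (simp add: line3_def case_prod_beta')

lemma line3_0 [simp]: "line3 P w 0 = P"
  by (simp add: line3_simps)

lemma line3_line3: "line3 (line3 P w s) w t = line3 P w (t + s)"
  by (simp add: line3_simps algebra_simps)

lemma line3_in_diffZ3:
  assumes "P \<in> diffZ3" "w \<in> vect3"
  obtains d where "d > 0" "\<And>t. \<bar>t\<bar> < d \<Longrightarrow> line3 P w t \<in> diffZ3"
proof -
  from assms have *: "fst P \<in> carrier diffZ" "fst (snd P) \<in> carrier diffZ" "snd (snd P) \<in> carrier diffZ"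
    "fst w \<in> vect" "fst (snd w) \<in> vect" "snd (snd w) \<in> vect" by auto
  obtain d1 where d1: "d1 > 0" "\<And>t. \<bar>t\<bar> < d1 \<Longrightarrow> (\<lambda>x. fst P x + t * fst w x) \<in> carrier diffZ"
    using diffZ_line[OF *(1,4)] by blast
  obtain d2 where d2: "d2 > 0" "\<And>t. \<bar>t\<bar> < d2 \<Longrightarrow> (\<lambda>x. fst (snd P) x + t * fst (snd w) x) \<in> carrier diffZ"
    using diffZ_line[OF *(2,5)] by blast
  obtain d3 where d3: "d3 > 0" "\<And>t. \<bar>t\<bar> < d3 \<Longrightarrow> (\<lambda>x. snd (snd P) x + t * snd (snd w) x) \<in> carrier diffZ"
    using diffZ_line[OF *(3,6)] by blast
  show thesis
    by (rule that[of "min d1 (min d2 d3)"]) (use d1 d2 d3 in \<open>auto simp: line3_simps\<close>)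
qed

text \<open>The same three projections serve base points and directions; collecting them in a set
  lets \<open>admissible\<close> have one rule for each kind instead of three.\<close>

definition comps :: "(fn \<times> fn \<times> fn \<Rightarrow> fn) set" where
  "comps = {fst, \<lambda>P. fst (snd P), \<lambda>P. snd (snd P)}"

lemma comps_line3: "pr \<in> comps \<Longrightarrow> pr (line3 P w t) = (\<lambda>x. pr P x + t * pr w x)"
  by (auto simp: comps_def line3_simps)

lemma comps_smooth:
  "pr \<in> comps \<Longrightarrow> P \<in> diffZ3 \<Longrightarrow> pr P \<in> smooth_fns" "pr \<in> comps \<Longrightarrow> w \<in> vect3 \<Longrightarrow> pr w \<in> smooth_fns"
  by (auto simp: comps_def diffZD vectD)

lemma continuous_map_comps:
  assumes "pr \<in> comps"
  shows "continuous_map T diffZ3_top F \<Longrightarrow> continuous_map T smooth_top (\<lambda>s. pr (F s))"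
    "continuous_map T vect3_top G \<Longrightarrow> continuous_map T smooth_top (\<lambda>s. pr (G s))"
proof -
  have d: "continuous_map diffZ3_top smooth_top pr"
    using assms continuous_map_projections3[of diffZ_top diffZ_top diffZ_top, THEN continuous_map_diffZ_smooth]
    by (auto simp: comps_def)
  have "continuous_map T smooth_top F" if "continuous_map T vect_top F" for T :: "(fn \<times> fn \<times> fn) topology" and F
    using that by (simp add: vect_top_def continuous_map_in_subtopology)
  note this[OF continuous_map_projections3(1)] this[OF continuous_map_projections3(2)] this[OF continuous_map_projections3(3)]
  then have v: "continuous_map vect3_top smooth_top pr"
    using assms by (auto simp: comps_def)
  show "continuous_map T diffZ3_top F \<Longrightarrow> continuous_map T smooth_top (\<lambda>s. pr (F s))"
    using continuous_map_compose[OF _ d] by (simp add: o_def)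
  show "continuous_map T vect3_top G \<Longrightarrow> continuous_map T smooth_top (\<lambda>s. pr (G s))"
    using continuous_map_compose[OF _ v] by (simp add: o_def)
qed

lemma deriv_pow_line:
  assumes "a \<in> smooth_fns" "b \<in> smooth_fns"
  shows "(deriv ^^ n) (\<lambda>x. a x + t * b x) = (\<lambda>x. (deriv ^^ n) a x + t * (deriv ^^ n) b x)"
proof (induction n)
  case (Suc n)
  show ?case
    using smooth_deriv_add[OF smooth_deriv_pow[OF assms(1)] smooth_scale[OF smooth_deriv_pow[OF assms(2)]], of n t n]
    by (simp add: Suc smooth_deriv_scale smooth_deriv_pow assms)
qed simp

text \<open>Functionals of a base point \<open>P\<close>, directions \<open>v 0, \<dots>, v (k - 1)\<close> and an integration variable \<open>r\<close>.
  The class contains the integrand of the cocycle and is closed under directional derivatives in \<open>P\<close>,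
  which raise \<open>k\<close>.\<close>

inductive admissible ::
  "nat \<Rightarrow> (fn \<times> fn \<times> fn \<Rightarrow> (nat \<Rightarrow> fn \<times> fn \<times> fn) \<Rightarrow> real \<Rightarrow> real) \<Rightarrow> bool" for k where
  var: "admissible k (\<lambda>P v r. r)"
| const: "admissible k (\<lambda>P v r. c)"
| base: "pr \<in> comps \<Longrightarrow> admissible k E \<Longrightarrow> admissible k (\<lambda>P v r. (deriv ^^ n) (pr P) (E P v r))"
| dir: "pr \<in> comps \<Longrightarrow> i < k \<Longrightarrow> admissible k E \<Longrightarrow> admissible k (\<lambda>P v r. (deriv ^^ n) (pr (v i)) (E P v r))"
| add: "admissible k E \<Longrightarrow> admissible k F \<Longrightarrow> admissible k (\<lambda>P v r. E P v r + F P v r)"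
| mult: "admissible k E \<Longrightarrow> admissible k F \<Longrightarrow> admissible k (\<lambda>P v r. E P v r * F P v r)"
| inverse: "admissible k E \<Longrightarrow> (\<And>P v r. P \<in> diffZ3 \<Longrightarrow> E P v r > 0) \<Longrightarrow> admissible k (\<lambda>P v r. inverse (E P v r))"
| ln: "admissible k E \<Longrightarrow> (\<And>P v r. P \<in> diffZ3 \<Longrightarrow> E P v r > 0) \<Longrightarrow> admissible k (\<lambda>P v r. ln (E P v r))"

lemma admissible_Suc: "admissible k E \<Longrightarrow> admissible (Suc k) E"
  by (induction rule: admissible.induct) (auto intro: admissible.intros)

text \<open>Continuity is stated along arbitrary continuous data over a test space \<open>T\<close>.
  The same lemma then serves integrability in \<open>r\<close>, the joint continuity in
  \<open>(t, r)\<close> demanded by the Leibniz rule, and continuity in base point and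
  directions.\<close>

lemma admissible_continuous:
  assumes "admissible k E"
    and a: "continuous_map T diffZ3_top a" and w: "\<And>i. i < k \<Longrightarrow> continuous_map T vect3_top (\<lambda>s. w s i)"
    and e: "continuous_map T euclideanreal e"
  shows "continuous_map T euclideanreal (\<lambda>s. E (a s) (w s) (e s))"
  using assms(1)
proof induction
  case var
  show ?case by (rule e)
next
  case (const c)
  show ?case by simp
next
  case (base pr E n)
  show ?case
    by (rule continuous_map_eval_deriv[OF continuous_map_comps(1)[OF base(1) a] base.IH])
next
  case (dir pr i E n)
  show ?case
    by (rule continuous_map_eval_deriv[OF continuous_map_comps(2)[OF dir(1) w[OF dir(2)]] dir.IH])
next
  case (add E F)
  show ?case by (rule continuous_map_add[OF add.IH])
next
  case (mult E F)
  show ?case by (rule continuous_map_real_mult[OF mult.IH])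
next
  case (inverse E)
  have "a s \<in> diffZ3" if "s \<in> topspace T" for s
    using continuous_map_image_subset_topspace[OF a] that by auto
  then have "E (a s) (w s) (e s) \<noteq> 0" if "s \<in> topspace T" for s
    using inverse(2)[of "a s" "w s" "e s"] that by auto
  then show ?case by (rule continuous_map_real_inverse[OF inverse.IH])
next
  case (ln E)
  have "a s \<in> diffZ3" if "s \<in> topspace T" for s
    using continuous_map_image_subset_topspace[OF a] that by auto
  then have "E (a s) (w s) (e s) \<in> {0<..}" if "s \<in> topspace T" for s
    using ln(2)[of "a s" "w s" "e s"] that by auto
  then show ?case
    by (intro continuous_map_compose_real[OF ln.IH, of "{0<..}" ln])
      (auto intro: continuous_on_ln continuous_on_id)
qed

text \<open>The direction \<open>v k\<close> is the first one that an \<open>admissible k\<close>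
  functional does not use, matching the recursion of \<open>dir_deriv3\<close>. Derivatives are
  taken at \<open>t = 0\<close> only; other points of a line become base points by
  \<open>line3_line3\<close>.\<close>

definition line_deriv where
  "line_deriv k E E' \<longleftrightarrow> (\<forall>P\<in>diffZ3. \<forall>v. (\<forall>i\<le>k. v i \<in> vect3) \<longrightarrow>
     (\<forall>r::real. ((\<lambda>t. E (line3 P (v k) t) v r) has_real_derivative E' P v r) (at 0)))"

lemma line_derivD:
  assumes "line_deriv k E E'" "P \<in> diffZ3" "\<forall>i\<le>k. v i \<in> vect3"
  shows "((\<lambda>t. E (line3 P (v k) t) v r) has_real_derivative E' P v r) (at 0)"
  using assms unfolding line_deriv_def by blast

text \<open>Symbolic differentiation by induction on the expression. Moving the base point is affine
  in \<open>t\<close>, so a component of \<open>P\<close> reproduces itself and the new direction,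
  and all other constructors follow the usual rules. The positivity conditions carry over because
  they are required at every point of \<open>diffZ3\<close>.\<close>

lemma admissible_line_deriv:
  assumes "admissible k E"
  shows "\<exists>E'. admissible (Suc k) E' \<and> line_deriv k E E'"
  using assms
proof induction
  case var
  show ?case
    by (intro exI[of _ "\<lambda>P v r. 0"]) (simp add: admissible.const line_deriv_def)
next
  case (const c)
  show ?case
    by (intro exI[of _ "\<lambda>P v r. 0"]) (simp add: admissible.const line_deriv_def)
next
  case (base pr E n)
  then obtain E' where E': "admissible (Suc k) E'" "line_deriv k E E'" by blast
  note E = admissible_Suc[OF base(2)]
  \<comment> \<open>The first term comes from the moving evaluation point, the second from the
    moving base function; the second introduces direction \<open>k\<close>.\<close>
  let ?D = "\<lambda>P v r. (deriv ^^ Suc n) (pr P) (E P v r) * E' P v r + (deriv ^^ n) (pr (v k)) (E P v r)"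
  have "admissible (Suc k) ?D"
    by (intro admissible.add admissible.mult admissible.base[OF base(1) E] admissible.dir[OF base(1) _ E] E'(1)) simp
  moreover have "line_deriv k (\<lambda>P v r. (deriv ^^ n) (pr P) (E P v r)) ?D"
    unfolding line_deriv_def
  proof (intro ballI allI impI)
    fix P v and r :: real assume P: "P \<in> diffZ3" and v: "\<forall>i\<le>k. v i \<in> vect3"
    let ?e = "\<lambda>t. E (line3 P (v k) t) v r"
    have s: "pr P \<in> smooth_fns" "pr (v k) \<in> smooth_fns"
      using comps_smooth base(1) P v by auto
    have e: "(?e has_real_derivative E' P v r) (at 0)" by (rule line_derivD[OF E'(2) P v])
    have c: "((\<lambda>t. (deriv ^^ n) a (?e t)) has_real_derivative (deriv ^^ Suc n) a (E P v r) * E' P v r) (at 0)"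
      if "a \<in> smooth_fns" for a
      using DERIV_chain2[OF _ e, of "(deriv ^^ n) a"] deriv_pow_has_deriv[OF that, of n "E P v r"] by simp
    \<comment> \<open>Along the line the function is a sum with a summand carrying an explicit
      factor \<open>t\<close>; at \<open>t = 0\<close> the product rule leaves only the derivative
      of that factor.\<close>
    have "((\<lambda>t. (deriv ^^ n) (pr P) (?e t) + t * (deriv ^^ n) (pr (v k)) (?e t)) has_real_derivative
       (deriv ^^ Suc n) (pr P) (E P v r) * E' P v r
        + (1 * (deriv ^^ n) (pr (v k)) (?e 0) + (deriv ^^ Suc n) (pr (v k)) (E P v r) * E' P v r * 0)) (at 0)"
      by (intro DERIV_add DERIV_mult c s DERIV_ident)
    then show "((\<lambda>t. (deriv ^^ n) (pr (line3 P (v k) t)) (?e t)) has_real_derivative ?D P v r) (at 0)"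
      by (simp add: comps_line3[OF base(1)] deriv_pow_line[OF s])
  qed
  ultimately show ?case by blast
next
  case (dir pr i E n)
  then obtain E' where E': "admissible (Suc k) E'" "line_deriv k E E'" by blast
  note E = admissible_Suc[OF dir(3)]
  let ?D = "\<lambda>P v r. (deriv ^^ Suc n) (pr (v i)) (E P v r) * E' P v r"
  have "admissible (Suc k) ?D"
    using dir(2) by (intro admissible.mult admissible.dir[OF dir(1) _ E] E'(1)) simp
  moreover have "line_deriv k (\<lambda>P v r. (deriv ^^ n) (pr (v i)) (E P v r)) ?D"
    unfolding line_deriv_def
  proof (intro ballI allI impI)
    fix P v and r :: real assume P: "P \<in> diffZ3" and v: "\<forall>i\<le>k. v i \<in> vect3"
    have s: "pr (v i) \<in> smooth_fns"
      using comps_smooth dir(1,2) v by auto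
    show "((\<lambda>t. (deriv ^^ n) (pr (v i)) (E (line3 P (v k) t) v r)) has_real_derivative ?D P v r) (at 0)"
      using DERIV_chain2[OF _ line_derivD[OF E'(2) P v], of "(deriv ^^ n) (pr (v i))"]
        deriv_pow_has_deriv[OF s, of n "E P v r"] by simp
  qed
  ultimately show ?case by blast
next
  case (add E F)
  then obtain E' F' where E': "admissible (Suc k) E'" "line_deriv k E E'" "admissible (Suc k) F'" "line_deriv k F F'"
    by blast
  have "line_deriv k (\<lambda>P v r. E P v r + F P v r) (\<lambda>P v r. E' P v r + F' P v r)"
    using E'(2,4) unfolding line_deriv_def by (simp add: DERIV_add)
  then show ?case using admissible.add[OF E'(1,3)] by blast
next
  case (mult E F)
  then obtain E' F' where E': "admissible (Suc k) E'" "line_deriv k E E'" "admissible (Suc k) F'" "line_deriv k F F'"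
    by blast
  let ?D = "\<lambda>P v r. E' P v r * F P v r + F' P v r * E P v r"
  have "line_deriv k (\<lambda>P v r. E P v r * F P v r) ?D"
    unfolding line_deriv_def
  proof (intro ballI allI impI)
    fix P v and r :: real assume P: "P \<in> diffZ3" and v: "\<forall>i\<le>k. v i \<in> vect3"
    show "((\<lambda>t. E (line3 P (v k) t) v r * F (line3 P (v k) t) v r) has_real_derivative ?D P v r) (at 0)"
      using DERIV_mult[OF line_derivD[OF E'(2) P v, of r] line_derivD[OF E'(4) P v, of r]] by simp
  qed
  moreover have "admissible (Suc k) ?D"
    by (intro admissible.add admissible.mult E' admissible_Suc mult(1,2))
  ultimately show ?case by blast
next
  case (inverse E)
  then obtain E' where E': "admissible (Suc k) E'" "line_deriv k E E'" by blast
  let ?I = "\<lambda>P v r. inverse (E P v r)"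
  let ?D = "\<lambda>P v r. (- 1) * (?I P v r * E' P v r * ?I P v r)"
  have I: "admissible (Suc k) ?I"
    by (rule admissible.inverse[OF admissible_Suc[OF inverse(1)] inverse(2)])
  have "admissible (Suc k) ?D"
    by (intro admissible.mult[OF admissible.const] admissible.mult[OF admissible.mult] I E'(1))
  moreover have "line_deriv k ?I ?D"
    unfolding line_deriv_def
  proof (intro ballI allI impI)
    fix P v and r :: real assume P: "P \<in> diffZ3" and v: "\<forall>i\<le>k. v i \<in> vect3"
    have "E P v r \<noteq> 0" using inverse(2)[OF P, of v r] by simp
    then show "((\<lambda>t. ?I (line3 P (v k) t) v r) has_real_derivative ?D P v r) (at 0)"
      using DERIV_inverse'[OF line_derivD[OF E'(2) P v, of r]] by simp
  qed
  ultimately show ?case by blast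
next
  case (ln E)
  then obtain E' where E': "admissible (Suc k) E'" "line_deriv k E E'" by blast
  let ?D = "\<lambda>P v r. inverse (E P v r) * E' P v r"
  have "admissible (Suc k) ?D"
    by (intro admissible.mult admissible.inverse[OF admissible_Suc[OF ln(1)] ln(2)] E'(1))
  moreover have "line_deriv k (\<lambda>P v r. ln (E P v r)) ?D"
    unfolding line_deriv_def
  proof (intro ballI allI impI)
    fix P v and r :: real assume P: "P \<in> diffZ3" and v: "\<forall>i\<le>k. v i \<in> vect3"
    have "(ln has_real_derivative inverse (E P v r)) (at (E (line3 P (v k) 0) v r))"
      using DERIV_ln[of "E P v r"] ln(2)[OF P, of v r] by simp
    then show "((\<lambda>t. ln (E (line3 P (v k) t) v r)) has_real_derivative ?D P v r) (at 0)"
      by (rule DERIV_chain2[OF _ line_derivD[OF E'(2) P v]])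
  qed
  ultimately show ?case by blast
qed

section \<open>Differentiation under the integral sign along lines\<close>

lemma continuous_map_line3:
  assumes "continuous_on S t" "P \<in> diffZ3" "w \<in> vect3" "\<And>s. s \<in> S \<Longrightarrow> line3 P w (t s) \<in> diffZ3"
  shows "continuous_map (top_of_set S) diffZ3_top (\<lambda>s. line3 P w (t s))"
proof -
  have "continuous_map (top_of_set S) smooth_top (\<lambda>s x. a x + t s * b x)" if "a \<in> smooth_fns" "b \<in> smooth_fns" for a b
    by (intro smooth_family_add smooth_family_mult smooth_family_const) (use that assms(1) in auto)
  then show ?thesis
    using assms(2-4) unfolding line3_simps
    by (intro continuous_map_pairedI) (auto simp: continuous_map_diffZ_iff diffZD vectD)
qed

text \<open>The Leibniz rule asks for the derivative on a whole neighbourhood \<open>U\<close> of 0.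
  It exists because short line segments stay inside the group, so every point of the segment is a
  legitimate base point.\<close>

lemma integral_line_deriv:
  assumes E: "admissible k E" "admissible (Suc k) E'" "line_deriv k E E'"
    and P: "P \<in> diffZ3" and v: "\<forall>i\<le>k. v i \<in> vect3"
  shows "((\<lambda>t. integral {0..1} (E (line3 P (v k) t) v)) has_real_derivative integral {0..1} (E' P v)) (at 0)"
proof -
  have vk: "v k \<in> vect3" using v by blast
  obtain d where d: "d > 0" "\<And>t. \<bar>t\<bar> < d \<Longrightarrow> line3 P (v k) t \<in> diffZ3"
    using line3_in_diffZ3[OF P vk] by blast
  define U where "U = {- d<..<d}"
  have L: "line3 P (v k) t \<in> diffZ3" if "t \<in> U" for t using d(2) that by (auto simp: U_def)
  have "((\<lambda>t. integral (cbox 0 1) (E (line3 P (v k) t) v)) has_real_derivative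
      integral (cbox 0 1) (E' (line3 P (v k) 0) v)) (at 0 within U)"
  proof (rule leibniz_rule_field_derivative)
    show "((\<lambda>t. E (line3 P (v k) t) v r) has_real_derivative E' (line3 P (v k) t) v r) (at t within U)"
      if "t \<in> U" for t r
      \<comment> \<open>The derivative at \<open>t\<close> is the derivative at 0 for the base point
        moved to \<open>t\<close>, transported by a shift of the line parameter.\<close>
      using line_derivD[OF E(3) L[OF that] v, of r] unfolding line3_line3
        DERIV_shift[of "\<lambda>t. E (line3 P (v k) t) v r" _ 0 t, symmetric]
      by (simp add: has_field_derivative_at_within)
    show "E (line3 P (v k) t) v integrable_on cbox 0 1" if "t \<in> U" for t
    proof (rule integrable_continuous)
      have "continuous_map (top_of_set (cbox 0 1)) euclideanreal (\<lambda>r. E (line3 P (v k) t) v r)"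
        by (rule admissible_continuous[OF E(1)]) (use L[OF that] v in auto)
      then show "continuous_on (cbox 0 1) (E (line3 P (v k) t) v)" by simp
    qed
    have "continuous_map (top_of_set (U \<times> cbox 0 1)) euclideanreal (\<lambda>z. E' (line3 P (v k) (fst z)) v (snd z))"
    proof (rule admissible_continuous[OF E(2)])
      show "continuous_map (top_of_set (U \<times> cbox 0 1)) diffZ3_top (\<lambda>z. line3 P (v k) (fst z))"
        by (rule continuous_map_line3[OF _ P vk]) (use L in \<open>auto intro: continuous_on_fst continuous_on_id\<close>)
      show "continuous_map (top_of_set (U \<times> cbox 0 1)) vect3_top (\<lambda>z. v i)" if "i < Suc k" for i
        using v that by simp
      show "continuous_map (top_of_set (U \<times> cbox 0 (1::real))) euclideanreal snd"
        by (auto intro: continuous_on_snd continuous_on_id)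
    qed
    then show "continuous_on (U \<times> cbox 0 1) (\<lambda>(t, r). E' (line3 P (v k) t) v r)"
      by (simp add: case_prod_beta')
  qed (use d(1) in \<open>auto simp: U_def\<close>)
  moreover have "at 0 within U = at 0"
    using d(1) by (intro at_within_open) (auto simp: U_def)
  ultimately show ?thesis by simp
qed

text \<open>Unfolding \<open>antideriv\<close> at the endpoint \<open>\<Xi> 0\<close> gives an
  integral over \<open>{0..1}\<close> whose evaluation points \<open>r * \<Xi> 0\<close> are
  themselves admissible. The logarithm and the reciprocal are admissible because derivatives of
  elements of \<open>diffZ\<close> are positive.\<close>

lemma gv_cochain_integrand:
  "\<exists>E. admissible 0 E \<and> (\<forall>P\<in>diffZ3. \<forall>v. dir_deriv3 gv_cochain 0 P v = integral {0..1} (E P v))"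
proof -
  have c: "fst \<in> comps" "(\<lambda>P. fst (snd P)) \<in> comps" "(\<lambda>P. snd (snd P)) \<in> comps"
    by (auto simp: comps_def)
  let ?x = "\<lambda>P v r. snd (snd P) 0"
  let ?y = "\<lambda>P v r. r * snd (snd P) 0"
  have x: "admissible 0 ?x"
    using admissible.base[OF c(3) admissible.const, of 0 0] by simp
  have y: "admissible 0 ?y"
    by (rule admissible.mult[OF admissible.var x])
  have "admissible 0 (\<lambda>P v r. fst (snd P) (?y P v r))"
    using admissible.base[OF c(2) y, of 0] by simp
  then have "admissible 0 (\<lambda>P v r. deriv (fst P) (fst (snd P) (?y P v r)))"
    using admissible.base[OF c(1), of 0 _ 1] by simp
  then have 1: "admissible 0 (\<lambda>P v r. ln (deriv (fst P) (fst (snd P) (?y P v r))))"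
    by (rule admissible.ln) (auto simp: diffZD)
  have 2: "admissible 0 (\<lambda>P v r. deriv (deriv (fst (snd P))) (?y P v r))"
    using admissible.base[OF c(2) y, of 2] by (simp add: numeral_2_eq_2)
  have "admissible 0 (\<lambda>P v r. deriv (fst (snd P)) (?y P v r))"
    using admissible.base[OF c(2) y, of 1] by simp
  then have 3: "admissible 0 (\<lambda>P v r. inverse (deriv (fst (snd P)) (?y P v r)))"
    by (rule admissible.inverse) (auto simp: diffZD)
  let ?E = "\<lambda>P v r. (- 1) * ?x P v r * (ln (deriv (fst P) (fst (snd P) (?y P v r))) *
     (deriv (deriv (fst (snd P))) (?y P v r) * inverse (deriv (fst (snd P)) (?y P v r))))"
  have "admissible 0 ?E"
    by (rule admissible.mult[OF admissible.mult[OF admissible.const x] admissible.mult[OF 1 admissible.mult[OF 2 3]]])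
  moreover have "dir_deriv3 gv_cochain 0 P v = integral {0..1} (?E P v)" if "P \<in> diffZ3" for P v
  proof -
    obtain \<Phi> \<Psi> \<Xi> where [simp]: "P = (\<Phi>, \<Psi>, \<Xi>)" by (cases P) auto
    have \<Psi>: "\<Psi> \<in> carrier diffZ" using that by simp
    have "deriv (log_deriv \<Psi>) x = deriv (deriv \<Psi>) x * inverse (deriv \<Psi> x)" for x
      unfolding log_deriv_def
      by (rule DERIV_imp_deriv)
        (use diffZD(2)[OF \<Psi>] smooth_has_deriv[OF smooth_deriv[OF diffZD(1)[OF \<Psi>]]] in
          \<open>auto intro!: derivative_eq_intros simp: divide_inverse\<close>)
    then have "?E P v = (\<lambda>r. - \<Xi> 0 * B1 \<Phi> \<Psi> (r * \<Xi> 0))"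
      by (simp add: B1_def pullback0_def log_deriv_def)
    then show ?thesis
      by (simp add: gv_cochain_def B1_primitive_def antideriv_def)
  qed
  ultimately show ?thesis by blast
qed

text \<open>The integral formula of order \<open>k\<close> is known only on \<open>diffZ3\<close>.
  Since that contains a short segment in direction \<open>v k\<close>, the formula holds for all
  small \<open>t\<close> and may be differentiated there.\<close>

lemma dir_deriv3_gv_cochain:
  "\<exists>E. admissible k E \<and>
     (\<forall>P\<in>diffZ3. \<forall>v. (\<forall>i<k. v i \<in> vect3) \<longrightarrow> dir_deriv3 gv_cochain k P v = integral {0..1} (E P v))"
proof (induction k)
  case 0
  then show ?case using gv_cochain_integrand by auto
next
  case (Suc k)
  then obtain E where E: "admissible k E"
    "\<And>P v. P \<in> diffZ3 \<Longrightarrow> (\<forall>i<k. v i \<in> vect3) \<Longrightarrow> dir_deriv3 gv_cochain k P v = integral {0..1} (E P v)"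
    by blast
  obtain E' where E': "admissible (Suc k) E'" "line_deriv k E E'"
    using admissible_line_deriv[OF E(1)] by blast
  have "dir_deriv3 gv_cochain (Suc k) P v = integral {0..1} (E' P v)"
    if P: "P \<in> diffZ3" and v: "\<forall>i<Suc k. v i \<in> vect3" for P v
  proof -
    obtain d where d: "d > 0" "\<And>t. \<bar>t\<bar> < d \<Longrightarrow> line3 P (v k) t \<in> diffZ3"
      using line3_in_diffZ3[OF P, of "v k"] v by blast
    have "\<forall>\<^sub>F t in nhds 0. t \<in> {- d<..<d}"
      using d(1) by (intro eventually_nhds_in_open) auto
    then have "\<forall>\<^sub>F t in nhds 0. dir_deriv3 gv_cochain k (line3 P (v k) t) v = integral {0..1} (E (line3 P (v k) t) v)"
      by eventually_elim (use d(2) v in \<open>auto intro!: E(2)\<close>)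
    then have "dir_deriv3 gv_cochain (Suc k) P v = deriv (\<lambda>t. integral {0..1} (E (line3 P (v k) t) v)) 0"
      by (auto intro: deriv_cong_ev)
    also have "\<dots> = integral {0..1} (E' P v)"
      using v by (intro DERIV_imp_deriv integral_line_deriv E(1) E' P) auto
    finally show ?thesis .
  qed
  then show ?case using E'(1) by blast
qed

text \<open>Both requirements are read off the integral formula: existence of the next directional
  derivative from the Leibniz rule, joint continuity from continuity of the integrand in all
  variables including \<open>r\<close>.\<close>

lemma smooth_gv_cochain: "smooth_cochain3 gv_cochain"
  unfolding smooth_cochain3_def
proof (intro allI conjI ballI)
  fix k
  obtain E where E: "admissible k E"
    "\<And>P v. P \<in> diffZ3 \<Longrightarrow> (\<forall>i<k. v i \<in> vect3) \<Longrightarrow> dir_deriv3 gv_cochain k P v = integral {0..1} (E P v)"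
    using dir_deriv3_gv_cochain by blast
  {
    fix P v assume P: "P \<in> diffZ3" and v: "v \<in> {..k} \<rightarrow>\<^sub>E vect3"
    then have v: "\<forall>i\<le>k. v i \<in> vect3" by auto
    obtain E' where E': "admissible (Suc k) E'" "line_deriv k E E'"
      using admissible_line_deriv[OF E(1)] by blast
    obtain d where d: "d > 0" "\<And>t. \<bar>t\<bar> < d \<Longrightarrow> line3 P (v k) t \<in> diffZ3"
      using line3_in_diffZ3[OF P, of "v k"] v by blast
    have "((\<lambda>t. integral {0..1} (E (line3 P (v k) t) v)) has_real_derivative integral {0..1} (E' P v)) (at 0)"
      by (rule integral_line_deriv[OF E(1) E' P v])
    then have "((\<lambda>t. dir_deriv3 gv_cochain k (line3 P (v k) t) v) has_real_derivative integral {0..1} (E' P v)) (at 0)"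
      by (rule has_field_derivative_transform_within_open[where S = "{- d<..<d}"])
        (use d v in \<open>auto intro!: E(2)[symmetric]\<close>)
    then show "(\<lambda>t. dir_deriv3 gv_cochain k (line3 P (v k) t) v) differentiable at 0"
      by (auto simp: real_differentiable_def)
  }
  let ?T = "prod_topology diffZ3_top (product_topology (\<lambda>_. vect3_top) {..<k})"
  have "jointly_continuous ?T (\<lambda>p. E (fst p) (snd p))"
  proof (rule admissible_continuous[OF E(1)])
    show "continuous_map (prod_topology ?T euclideanreal) diffZ3_top (\<lambda>z. fst (fst z))"
      using continuous_map_compose[OF continuous_map_fst continuous_map_fst] by (simp add: o_def)
    fix i assume "i < k"
    then have "continuous_map (product_topology (\<lambda>_. vect3_top) {..<k}) vect3_top (\<lambda>v. v i)"
      by (intro continuous_map_product_projection) auto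
    from continuous_map_compose[OF continuous_map_compose[OF continuous_map_fst continuous_map_snd] this]
    show "continuous_map (prod_topology ?T euclideanreal) vect3_top (\<lambda>z. snd (fst z) i)"
      by (simp add: o_def)
  qed (rule continuous_map_snd)
  then have "continuous_map ?T euclideanreal (\<lambda>p. integral {0..1} (E (fst p) (snd p)))"
    by (rule jointly_continuous_integral)
  then show "continuous_map ?T euclideanreal (\<lambda>(P, v). dir_deriv3 gv_cochain k P v)"
  proof (rule continuous_map_eq)
    fix p assume "p \<in> topspace ?T"
    then have "fst p \<in> diffZ3" "\<forall>i<k. snd p i \<in> vect3"
      by (auto simp: mem_Times_iff PiE_iff)
    then show "integral {0..1} (E (fst p) (snd p)) = (case p of (P, v) \<Rightarrow> dir_deriv3 gv_cochain k P v)"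
      by (simp only: case_prod_beta' E(2))
  qed
qed

text \<open>The cocycle serves as its own smooth representative, the zero 2-cochain placing it in
  its own class.\<close>

lemma gv_cochain_is_godbillon_vey: "is_godbillon_vey_class (grp_coh3 diffZ diffZ_top `` {gv_cochain})"
proof -
  have "gv_cochain \<in> grp_coh3 diffZ diffZ_top `` {gv_cochain}"
    using gv_cochain_Z3
    by (auto simp: grp_coh3_def cont_cochain2_def cobd2_def case_prod_beta' intro!: exI[of _ "\<lambda>x y. 0"])
  moreover have "van_est_map gv_cochain \<in> lie_class theta0"
    by (rule lie_class_cong[OF theta0_Z3 van_est_map_gv_cochain])
  moreover have "lie_class theta0 \<in> lie_H3"
    unfolding lie_H3_def lie_class_def by (rule quotientI[OF theta0_Z3])
  moreover have "grp_coh3 diffZ diffZ_top `` {gv_cochain} \<in> grp_H3 diffZ diffZ_top"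
    unfolding grp_H3_def by (rule quotientI[OF gv_cochain_Z3])
  ultimately show ?thesis
    using smooth_gv_cochain by (auto simp: is_godbillon_vey_class_def van_est_iso_def)
qed

theorem theorem7:
  shows "crossed_module_seq real_grp const_fn F0 mu F1_ext snd diffZ F1_ext_act \<and>
         (\<exists>K. cm_represents const_fn F0 smooth_top mu F1_ext F1_ext_top snd diffZ diffZ_top F1_ext_act K \<and>
              is_godbillon_vey_class K)"
  using F1_ext_crossed_module_seq gv_cochain_represents gv_cochain_is_godbillon_vey by blast

end
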